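(* Assume that $\mathbf{k}=(k_1,k_2,k_3)^{\top}$ is nonzero with $0\le k_1,k_2,k_3\le \frac{1}{2a}$. Then the matrix $C\in\mathbb{C}^{3n\times 3n}$ has the singular value decomposition $$C = P\,\mathrm{diag}\left(\Lambda_q^{1/2},\Lambda_q^{1/2},0\right)Q^{*} = P_r\,\Sigma_r\,Q_r^{*},$$ where $P=[P_2,\,P_1,\,P_0]$, $Q=[Q_1,\,Q_2,\,Q_0]$, $P_r=[P_2,\,P_1]$, $Q_r=[Q_1,\,Q_2]$ and $\Sigma_r=\mathrm{diag}(\Lambda_q^{1/2},\Lambda_q^{1/2})$.
   Context: Notation: $\imath=\sqrt{-1}$, $I_m$ is the $m\times m$ identity, $\otimes$ is the Kronecker product, $^{*}$ is the conjugate transpose. Grid: $n_1,n_2,n_3\ge 2$ are integers, $n=n_1n_2n_3$; $\delta_x,\delta_y,\delta_z>0$ are mesh lengths; $a>0$ is the lattice constant, $\mathbf{a}_\ell=a\,e_\ell$ with $e_\ell$ the $\ell$-th unit vector of $\mathbb{R}^3$ ($\ell=1,2,3$); $\mathbf{k}\in\mathbb{R}^3$. Discrete curl: for a vector $\mathbf{a}\in\mathbb{R}^3$ and integer $m\ge 2$, $K_{\mathbf{a},m}\in\mathbb{C}^{m\times m}$ has $-1$ on the diagonal, $1$ on the first superdiagonal, $e^{\imath 2\pi\mathbf{k}\cdot\mathbf{a}}$ in position $(m,1)$, and zeros elsewhere. Put $$C_1=\delta_x^{-1}(I_{n_3}\otimes I_{n_2}\otimes K_{\mathbf{a}_1,n_1}),\quad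 C_2=\delta_y^{-1}(I_{n_3}\otimes K_{\mathbf{a}_2,n_2}\otimes I_{n_1}),\quad C_3=\delta_z^{-1}(K_{\mathbf{a}_3,n_3}\otimes I_{n_2}\otimes I_{n_1}),$$ $$C=\begin{bmatrix}0&-C_3&C_2\\ C_3&0&-C_1\\ -C_2&C_1&0\end{bmatrix}\in\mathbb{C}^{3n\times 3n}.$$ Diagonalizing matrices: $\theta_{m,i}=\frac{\imath 2\pi i}{m}$, $\theta_{\mathbf{a},m}=\frac{\imath 2\pi\mathbf{k}\cdot\mathbf{a}}{m}$, $D_{\mathbf{a},m}=\mathrm{diag}(1,e^{\theta_{\mathbf{a},m}},\dots,e^{(m-1)\theta_{\mathbf{a},m}})$, $U_m\in\mathbb{C}^{m\times m}$ is the matrix with columns $(1,e^{\theta_{m,i}},\dots,e^{(m-1)\theta_{m,i}})^{\top}$, $i=0,\dots,m-1$, and $\Lambda_{\mathbf{a},m}=\mathrm{diag}(e^{\theta_{m,0}+\theta_{\mathbf{a},m}}-1,\dots,e^{\theta_{m,m-1}+\theta_{\mathbf{a},m}}-1)$. Set $$T=\tfrac{1}{\sqrt n}(D_{\mathbf{a}_3,n_3}\otimes D_{\mathbf{a}_2,n_2}\otimes D_{\mathbf{a}_1,n_1})(U_{n_3}\otimes U_{n_2}\otimes U_{n_1}),$$ $$\Lambda_1=\delta_x^{-1}(I_{n_3}\otimes I_{n_2}\otimes\Lambda_{\mathbf{a}_1,n_1}),\quad \Lambda_2=\delta_y^{-1}(I_{n_3}\otimes\Lambda_{\mathbf{a}_2,n_2}\otimes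 I_{n_1}),\quad \Lambda_3=\delta_z^{-1}(\Lambda_{\mathbf{a}_3,n_3}\otimes I_{n_2}\otimes I_{n_1}).$$ Let $\alpha,\beta$ be nonzero real numbers with $\alpha\delta_x\ne\beta\delta_y$ and $\delta_z\ne\beta\delta_y$, and let $$\Lambda_q=\Lambda_1^{*}\Lambda_1+\Lambda_2^{*}\Lambda_2+\Lambda_3^{*}\Lambda_3,\quad \Lambda_p=\begin{bmatrix}\beta\Lambda_3-\Lambda_2\\ \Lambda_1-\alpha\Lambda_3\\ \alpha\Lambda_2-\beta\Lambda_1\end{bmatrix},\quad T_1=\begin{bmatrix}\alpha T\\ \beta T\\ T\end{bmatrix}.$$ (Under the assumption on $\mathbf{k}$, the diagonal matrices $\Lambda_q$ and $\Lambda_p^{*}\Lambda_p$ are positive definite.) Singular vector blocks (each $3n\times n$): with $\Pi_0=\begin{bmatrix}\Lambda_1\\ \Lambda_2\\ \Lambda_3\end{bmatrix}\Lambda_q^{-1/2}$ and $\overline{\Pi_0}$ its entrywise conjugate, $$Q_0=(I_3\otimes T)\Pi_0,\quad P_0=(I_3\otimes T)\overline{\Pi_0},$$ $$Q_1=(I-Q_0Q_0^{*})T_1(\Lambda_p^{*}\Lambda_p\Lambda_q^{-1})^{-1/2},\quad P_1=(I-P_0P_0^{*})T_1(\Lambda_p^{*}\Lambda_p\Lambda_q^{-1})^{-1/2},$$ $$Q_2=C^{*}T_1(\Lambda_p^{*}\Lambda_p)^{-1/2},\quad P_2=CT_1(\Lambda_p^{*}\Lambda_p)^{-1/2}.$$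 Singular value decomposition means that $P$ and $Q$ are unitary and the middle factor is diagonal with nonnegative entries (not necessarily ordered). *)

theory Defs
  imports Complex_Main "Jordan_Normal_Form.Schur_Decomposition"
begin

definition kronecker :: "complex mat \<Rightarrow> complex mat \<Rightarrow> complex mat" (infixr \<open>\<otimes>\<^sub>K\<close> 72) where
  "A \<otimes>\<^sub>K B = mat (dim_row A * dim_row B) (dim_col A * dim_col B)
     (\<lambda>(i, j). A $$ (i div dim_row B, j div dim_col B) * B $$ (i mod dim_row B, j mod dim_col B))"

definition append_cols :: "complex mat \<Rightarrow> complex mat \<Rightarrow> complex mat" (infixr \<open>@\<^sub>c\<close> 67) where
  "A @\<^sub>c B = four_block_mat A B (0\<^sub>m 0 (dim_col A)) (0\<^sub>m 0 (dim_col B))"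

definition unitary_mat :: "complex mat \<Rightarrow> bool" where
  "unitary_mat U \<longleftrightarrow> square_mat U \<and> mat_adjoint U * U = 1\<^sub>m (dim_row U)
     \<and> U * mat_adjoint U = 1\<^sub>m (dim_row U)"

(* The singular values need not be ordered. The order on complex numbers from Complex_Order is
   such that 0 \<le> z means that z is real and nonnegative. *)
definition is_svd :: "complex mat \<Rightarrow> complex mat \<Rightarrow> complex mat \<Rightarrow> complex mat \<Rightarrow> bool" where
  "is_svd A P S Q \<longleftrightarrow>
     P \<in> carrier_mat (dim_row A) (dim_row A) \<and> unitary_mat P \<and>
     Q \<in> carrier_mat (dim_col A) (dim_col A) \<and> unitary_mat Q \<and>
     S \<in> carrier_mat (dim_row A) (dim_col A) \<and> diagonal_mat S \<and>
     (\<forall>i < min (dim_row A) (dim_col A). 0 \<le> S $$ (i, i)) \<and>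
     A = P * S * mat_adjoint Q"

(* Inverse and square root of a diagonal matrix; only applied below to diagonal matrices with
   positive diagonal entries, where csqrt is the positive real square root. *)
definition diag_inverse :: "complex mat \<Rightarrow> complex mat" where
  "diag_inverse A = mat_diag (dim_row A) (\<lambda>i. inverse (A $$ (i, i)))"

definition diag_sqrt :: "complex mat \<Rightarrow> complex mat" where
  "diag_sqrt A = mat_diag (dim_row A) (\<lambda>i. csqrt (A $$ (i, i)))"

definition diag_inv_sqrt :: "complex mat \<Rightarrow> complex mat" where
  "diag_inv_sqrt A = diag_inverse (diag_sqrt A)"

text \<open>
  Rows, columns and the unit vectors are indexed from \<open>0\<close>, so the lattice vectors
  \<open>a\<^sub>1, a\<^sub>2, a\<^sub>3\<close> are \<open>lattice_vec a 0\<close>, \<open>lattice_vec a 1\<close>, \<open>lattice_vec a 2\<close>. In the matrices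
  below the argument \<open>v\<close> is a lattice vector and \<open>k\<close> is the wave vector.
\<close>

definition lattice_vec :: "real \<Rightarrow> nat \<Rightarrow> real vec" where
  "lattice_vec a l = a \<cdot>\<^sub>v unit_vec 3 l"

definition K_mat :: "real vec \<Rightarrow> real vec \<Rightarrow> nat \<Rightarrow> complex mat" where
  "K_mat k v m = mat m m (\<lambda>(i, j).
     if j = i then -1
     else if j = i + 1 then 1
     else if i = m - 1 \<and> j = 0 then exp (\<i> * of_real (2 * pi * (k \<bullet> v)))
     else 0)"

definition theta_idx :: "nat \<Rightarrow> nat \<Rightarrow> complex" where
  "theta_idx m i = \<i> * of_real (2 * pi * real i / real m)"

definition theta_vec :: "real vec \<Rightarrow> real vec \<Rightarrow> nat \<Rightarrow> complex" where
  "theta_vec k v m = \<i> * of_real (2 * pi * (k \<bullet> v) / real m)"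

definition D_mat :: "real vec \<Rightarrow> real vec \<Rightarrow> nat \<Rightarrow> complex mat" where
  "D_mat k v m = mat_diag m (\<lambda>j. exp (of_nat j * theta_vec k v m))"

definition U_mat :: "nat \<Rightarrow> complex mat" where
  "U_mat m = mat m m (\<lambda>(j, i). exp (of_nat j * theta_idx m i))"

definition Lambda_mat :: "real vec \<Rightarrow> real vec \<Rightarrow> nat \<Rightarrow> complex mat" where
  "Lambda_mat k v m = mat_diag m (\<lambda>i. exp (theta_idx m i + theta_vec k v m) - 1)"

context
  fixes n1 n2 n3 :: nat
    and dx dy dz a :: real
    and k :: "real vec"
    and \<alpha> \<beta> :: real
begin

definition grid_size :: nat where
  "grid_size = n1 * n2 * n3"

definition C1 :: "complex mat" where
  "C1 = of_real (inverse dx) \<cdot>\<^sub>m (1\<^sub>m n3 \<otimes>\<^sub>K 1\<^sub>m n2 \<otimes>\<^sub>K K_mat k (lattice_vec a 0) n1)"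

definition C2 :: "complex mat" where
  "C2 = of_real (inverse dy) \<cdot>\<^sub>m (1\<^sub>m n3 \<otimes>\<^sub>K K_mat k (lattice_vec a 1) n2 \<otimes>\<^sub>K 1\<^sub>m n1)"

definition C3 :: "complex mat" where
  "C3 = of_real (inverse dz) \<cdot>\<^sub>m (K_mat k (lattice_vec a 2) n3 \<otimes>\<^sub>K 1\<^sub>m n2 \<otimes>\<^sub>K 1\<^sub>m n1)"

definition curl_mat :: "complex mat" where
  "curl_mat =
     (let Z = 0\<^sub>m grid_size grid_size in
        (Z     @\<^sub>c - C3  @\<^sub>c C2)
     @\<^sub>r (C3    @\<^sub>c Z     @\<^sub>c - C1)
     @\<^sub>r (- C2  @\<^sub>c C1    @\<^sub>c Z))"

definition T_mat :: "complex mat" where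
  "T_mat = of_real (1 / sqrt (real grid_size)) \<cdot>\<^sub>m
     ((D_mat k (lattice_vec a 2) n3 \<otimes>\<^sub>K D_mat k (lattice_vec a 1) n2 \<otimes>\<^sub>K D_mat k (lattice_vec a 0) n1)
      * (U_mat n3 \<otimes>\<^sub>K U_mat n2 \<otimes>\<^sub>K U_mat n1))"

definition Lambda1 :: "complex mat" where
  "Lambda1 = of_real (inverse dx) \<cdot>\<^sub>m (1\<^sub>m n3 \<otimes>\<^sub>K 1\<^sub>m n2 \<otimes>\<^sub>K Lambda_mat k (lattice_vec a 0) n1)"

definition Lambda2 :: "complex mat" where
  "Lambda2 = of_real (inverse dy) \<cdot>\<^sub>m (1\<^sub>m n3 \<otimes>\<^sub>K Lambda_mat k (lattice_vec a 1) n2 \<otimes>\<^sub>K 1\<^sub>m n1)"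

definition Lambda3 :: "complex mat" where
  "Lambda3 = of_real (inverse dz) \<cdot>\<^sub>m (Lambda_mat k (lattice_vec a 2) n3 \<otimes>\<^sub>K 1\<^sub>m n2 \<otimes>\<^sub>K 1\<^sub>m n1)"

definition Lambda_q :: "complex mat" where
  "Lambda_q = mat_adjoint Lambda1 * Lambda1 + mat_adjoint Lambda2 * Lambda2
     + mat_adjoint Lambda3 * Lambda3"

definition Lambda_p :: "complex mat" where
  "Lambda_p =
        (of_real \<beta> \<cdot>\<^sub>m Lambda3 - Lambda2)
     @\<^sub>r (Lambda1 - of_real \<alpha> \<cdot>\<^sub>m Lambda3)
     @\<^sub>r (of_real \<alpha> \<cdot>\<^sub>m Lambda2 - of_real \<beta> \<cdot>\<^sub>m Lambda1)"

definition T1_mat :: "complex mat" where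
  "T1_mat = (of_real \<alpha> \<cdot>\<^sub>m T_mat) @\<^sub>r (of_real \<beta> \<cdot>\<^sub>m T_mat) @\<^sub>r T_mat"

definition Pi0 :: "complex mat" where
  "Pi0 = (Lambda1 @\<^sub>r Lambda2 @\<^sub>r Lambda3) * diag_inv_sqrt Lambda_q"

definition Q0 :: "complex mat" where
  "Q0 = (1\<^sub>m 3 \<otimes>\<^sub>K T_mat) * Pi0"

definition P0 :: "complex mat" where
  "P0 = (1\<^sub>m 3 \<otimes>\<^sub>K T_mat) * map_mat cnj Pi0"

definition Q1 :: "complex mat" where
  "Q1 = (1\<^sub>m (3 * grid_size) - Q0 * mat_adjoint Q0) * T1_mat
     * diag_inv_sqrt (mat_adjoint Lambda_p * Lambda_p * diag_inverse Lambda_q)"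

definition P1 :: "complex mat" where
  "P1 = (1\<^sub>m (3 * grid_size) - P0 * mat_adjoint P0) * T1_mat
     * diag_inv_sqrt (mat_adjoint Lambda_p * Lambda_p * diag_inverse Lambda_q)"

definition Q2 :: "complex mat" where
  "Q2 = mat_adjoint curl_mat * T1_mat * diag_inv_sqrt (mat_adjoint Lambda_p * Lambda_p)"

definition P2 :: "complex mat" where
  "P2 = curl_mat * T1_mat * diag_inv_sqrt (mat_adjoint Lambda_p * Lambda_p)"

definition P_full :: "complex mat" where
  "P_full = P2 @\<^sub>c P1 @\<^sub>c P0"

definition Q_full :: "complex mat" where
  "Q_full = Q1 @\<^sub>c Q2 @\<^sub>c Q0"

definition P_r :: "complex mat" where
  "P_r = P2 @\<^sub>c P1"

definition Q_r :: "complex mat" where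
  "Q_r = Q1 @\<^sub>c Q2"

definition Sigma_full :: "complex mat" where
  "Sigma_full = diag_block_mat [diag_sqrt Lambda_q, diag_sqrt Lambda_q, 0\<^sub>m grid_size grid_size]"

definition Sigma_r :: "complex mat" where
  "Sigma_r = diag_block_mat [diag_sqrt Lambda_q, diag_sqrt Lambda_q]"

end

end

theory Submission
  imports Defs
begin

text \<open>
  The discrete curl is block diagonalized by Bloch modes. Each one-dimensional quasi-periodic
  difference matrix \<open>K\<close> has the vectors \<open>(1, z, ..., z ^ (m - 1))\<close> as eigenvectors, where \<open>z\<close>
  ranges over the \<open>m\<close>-th roots of the boundary phase, and the eigenvalues are \<open>z - 1\<close>
  (\<open>K_mult_DU\<close>). These vectors are orthogonal (\<open>DU_orthogonal\<close>), so by the rules for Kronecker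
  products \<open>T\<close> is unitary and \<open>C\<^sub>j T = T \<Lambda>\<^sub>j\<close> for \<open>j = 1, 2, 3\<close>. Conjugation with \<open>I\<^sub>3 \<otimes> T\<close> therefore splits the
  \<open>3n \<times> 3n\<close> curl into \<open>n\<close> independent \<open>3 \<times> 3\<close> matrices, one for each mode \<open>i\<close>: the map
  \<open>v \<mapsto> l \<times> v\<close>, where \<open>l \<in> \<complex>\<^sup>3\<close> collects the \<open>i\<close>-th diagonal entries of
  \<open>\<Lambda>\<^sub>1, \<Lambda>\<^sub>2, \<Lambda>\<^sub>3\<close> (\<open>curl_mult_modes3\<close>, \<open>curl_eq\<close>).

  The decomposition of a single map \<open>l \<times> _\<close> is vector algebra in \<open>\<complex>\<^sup>3\<close>. Let \<open>w\<close> be the real vector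
  \<open>(\<alpha>, \<beta>, 1)\<close>, let \<open>\<sigma> = |l|\<close> and \<open>\<rho> = |l \<times> w|\<close>, and write \<open>l'\<close> for the conjugate of \<open>l\<close>. The normalized
  vectors in the directions

    \<^item> \<open>w - l \<langle>l, w\<rangle> / \<sigma>\<^sup>2\<close>, \<open>- l' \<times> w\<close>, \<open>l\<close> (right frame),
    \<^item> \<open>l \<times> w\<close>, \<open>w - l' \<langle>l', w\<rangle> / \<sigma>\<^sup>2\<close>, \<open>l'\<close> (left frame)

  form two orthonormal bases of \<open>\<complex>\<^sup>3\<close>: the orthogonality relations are vanishing triple products, and
  the norm of the first right vector is Lagrange's identity
  \<open>|l \<times> w|\<^sup>2 = |l|\<^sup>2 |w|\<^sup>2 - |\<langle>l, w\<rangle>|\<^sup>2\<close>. Since \<open>l \<times> l = 0\<close> and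
  \<open>l \<times> (l' \<times> w) = l' \<langle>l', w\<rangle> - \<sigma>\<^sup>2 w\<close>, the map \<open>l \<times> _\<close> sends the right frame to the left frame
  scaled by \<open>\<sigma>, \<sigma>, 0\<close> (\<open>cross_right_frame\<close>). The blocks \<open>Q\<^sub>1, Q\<^sub>2, Q\<^sub>0\<close> and \<open>P\<^sub>2, P\<^sub>1, P\<^sub>0\<close> are exactly these
  frames, transported back to the grid by \<open>I\<^sub>3 \<otimes> T\<close> (\<open>frames_eq\<close>).

  The normalizations make sense because \<open>\<sigma>\<close> and \<open>\<rho>\<close> are positive. If \<open>k\<^sub>j > 0\<close>, the phase
  \<open>a k\<^sub>j\<close> lies strictly between \<open>0\<close> and \<open>1\<close>, no root of the boundary phase equals \<open>1\<close>, and so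
  \<open>l \<noteq> 0\<close> (\<open>bloch_root_neq_1\<close>). If \<open>l \<times> w\<close> vanished, \<open>l\<close> would be a complex multiple of
  \<open>(\<alpha>, \<beta>, 1)\<close>. But \<open>1 + \<delta> c\<close> for the components \<open>c\<close> of \<open>l\<close> with their mesh lengths \<open>\<delta>\<close>
  lies on the unit circle, and a line through \<open>1\<close> meets that circle only once more; this forces
  \<open>\<delta>\<^sub>z = \<beta> \<delta>\<^sub>y\<close>, which is excluded (\<open>cross_nonzero\<close>).
\<close>

section \<open>Adjoints and Kronecker products\<close>

lemma adjoint_carrier [simp]: "A \<in> carrier_mat m p \<Longrightarrow> mat_adjoint A \<in> carrier_mat p m"
  unfolding mat_adjoint_def by (metis carrier_matD cols_length length_map mat_of_rows_carrier(1))

lemma dim_adjoint [simp]: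
  "dim_row (mat_adjoint A) = dim_col A" "dim_col (mat_adjoint A) = dim_row A"
  unfolding mat_adjoint_def by auto

lemma index_adjoint [simp]:
  fixes A :: "complex mat"
  assumes "i < dim_col A" "j < dim_row A"
  shows "mat_adjoint A $$ (i, j) = cnj (A $$ (j, i))"
  using assms unfolding mat_adjoint_def by (simp add: mat_of_rows_index)

lemma adjoint_mult:
  fixes A :: "complex mat"
  assumes "A \<in> carrier_mat m p" "B \<in> carrier_mat p r"
  shows "mat_adjoint (A * B) = mat_adjoint B * mat_adjoint A"
  using assms by (intro eq_matI) (auto simp: scalar_prod_def intro!: sum.cong)

text \<open>
  Splitting an index below \<open>R * n\<close> into quotient and remainder turns one sum into a double sum; both
  the Kronecker product and block matrices are multiplied this way.
\<close>

lemma sum_block: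
  fixes f :: "nat \<Rightarrow> complex"
  shows "sum f {0..<R * n} = (\<Sum>r<R. \<Sum>i<n. f (r * n + i))"
proof -
  have "sum f {0..<R * n} = (\<Sum>r<R. sum f {r * n..<r * n + n})"
    by (simp add: sum.nat_group atLeast0LessThan)
  also have "\<dots> = (\<Sum>r<R. \<Sum>i<n. f (r * n + i))"
  proof (rule sum.cong[OF refl])
    fix r
    show "sum f {r * n..<r * n + n} = (\<Sum>i<n. f (r * n + i))"
      using sum.shift_bounds_nat_ivl[of f 0 "r * n" n]
      by (simp add: atLeast0LessThan add.commute)
  qed
  finally show ?thesis .
qed

lemma div_less_block: "i < R * n \<Longrightarrow> i div n < (R::nat)"
  by (simp add: less_mult_imp_div_less)

lemma mod_less_block: "i < R * n \<Longrightarrow> i mod n < (n::nat)"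
  by (cases n) auto

lemma dim_kronecker [simp]:
  "dim_row (A \<otimes>\<^sub>K B) = dim_row A * dim_row B" "dim_col (A \<otimes>\<^sub>K B) = dim_col A * dim_col B"
  unfolding kronecker_def by auto

lemma kronecker_carrier:
  "A \<in> carrier_mat a b \<Longrightarrow> B \<in> carrier_mat c d \<Longrightarrow> A \<otimes>\<^sub>K B \<in> carrier_mat (a * c) (b * d)"
  unfolding kronecker_def by auto

text \<open>
  The mixed product property: it reduces every statement about the three-dimensional grid to
  statements about one coordinate direction.
\<close>

lemma kronecker_mult:
  assumes "A \<in> carrier_mat a b" "A' \<in> carrier_mat b c" "B \<in> carrier_mat d e" "B' \<in> carrier_mat e f"
  shows "(A \<otimes>\<^sub>K B) * (A' \<otimes>\<^sub>K B') = (A * A') \<otimes>\<^sub>K (B * B')"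
proof (rule eq_matI)
  fix i j assume "i < dim_row ((A * A') \<otimes>\<^sub>K (B * B'))" "j < dim_col ((A * A') \<otimes>\<^sub>K (B * B'))"
  with assms have i: "i < a * d" and j: "j < c * f" by auto
  have "((A \<otimes>\<^sub>K B) * (A' \<otimes>\<^sub>K B')) $$ (i, j) =
      (\<Sum>x\<in>{0..<b * e}. A $$ (i div d, x div e) * B $$ (i mod d, x mod e)
         * (A' $$ (x div e, j div f) * B' $$ (x mod e, j mod f)))"
    using i j assms by (simp add: kronecker_def scalar_prod_def)
  also have "\<dots> = (\<Sum>s<b. \<Sum>t<e. A $$ (i div d, s) * B $$ (i mod d, t)
         * (A' $$ (s, j div f) * B' $$ (t, j mod f)))"
    unfolding sum_block by (intro sum.cong) auto
  also have "\<dots> = (\<Sum>s<b. A $$ (i div d, s) * A' $$ (s, j div f))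
         * (\<Sum>t<e. B $$ (i mod d, t) * B' $$ (t, j mod f))"
    by (simp add: sum_product mult_ac)
  also have "\<dots> = ((A * A') \<otimes>\<^sub>K (B * B')) $$ (i, j)"
    using i j assms
    by (simp add: kronecker_def scalar_prod_def div_less_block mod_less_block atLeast0LessThan)
  finally show "((A \<otimes>\<^sub>K B) * (A' \<otimes>\<^sub>K B')) $$ (i, j) = ((A * A') \<otimes>\<^sub>K (B * B')) $$ (i, j)" .
qed (use assms in auto)

lemma kronecker_adjoint: "mat_adjoint (A \<otimes>\<^sub>K B) = mat_adjoint A \<otimes>\<^sub>K mat_adjoint B"
  by (intro eq_matI) (auto simp: kronecker_def div_less_block mod_less_block)

lemma kronecker_mat_diag:
  "mat_diag m f \<otimes>\<^sub>K mat_diag p g = mat_diag (m * p) (\<lambda>i. f (i div p) * g (i mod p))"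
  by (rule eq_matI)
    (auto simp: kronecker_def mat_diag_def div_less_block mod_less_block, metis div_mod_decomp)

lemma smult_kronecker: "(x \<cdot>\<^sub>m A) \<otimes>\<^sub>K (y \<cdot>\<^sub>m B) = (x * y) \<cdot>\<^sub>m (A \<otimes>\<^sub>K B)"
  by (intro eq_matI) (auto simp: kronecker_def div_less_block mod_less_block)

lemma one_smult: "1 \<cdot>\<^sub>m A = (A :: complex mat)"
  by (intro eq_matI) auto

lemma one_kronecker_one: "1\<^sub>m m \<otimes>\<^sub>K 1\<^sub>m p = 1\<^sub>m (m * p)"
  by (simp add: kronecker_mat_diag flip: mat_diag_one)

text \<open>
  A projection onto the orthogonal complement of a transported column space can be computed before
  the transport, since an isometry \<open>W\<close> preserves inner products.
\<close>

lemma projection_complement: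
  fixes W :: "complex mat"
  assumes W: "W \<in> carrier_mat N N" "mat_adjoint W * W = 1\<^sub>m N"
    and A: "A \<in> carrier_mat N n" and B: "B \<in> carrier_mat N m"
  shows "(1\<^sub>m N - (W * A) * mat_adjoint (W * A)) * (W * B) = W * ((1\<^sub>m N - A * mat_adjoint A) * B)"
proof -
  let ?W' = "mat_adjoint W" and ?A' = "mat_adjoint A"
  have c: "?W' \<in> carrier_mat N N" "?A' \<in> carrier_mat n N" using W A by auto
  have WA: "W * A \<in> carrier_mat N n" and WB: "W * B \<in> carrier_mat N m"
    and AB: "?A' * B \<in> carrier_mat n m"
    by (rule mult_carrier_mat[OF W(1) A] mult_carrier_mat[OF W(1) B] mult_carrier_mat[OF c(2) B])+
  have "?W' * (W * B) = B"
    using W B c by (simp add: assoc_mult_mat[symmetric, of _ N N _ N _ m])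
  then have 1: "(W * A) * mat_adjoint (W * A) * (W * B) = W * (A * (?A' * B))"
    by (simp only: adjoint_mult[OF W(1) A] assoc_mult_mat[OF WA mult_carrier_mat[OF c(2,1)] WB]
      assoc_mult_mat[OF c(2,1) WB] assoc_mult_mat[OF W(1) A AB])
  have "(1\<^sub>m N - (W * A) * mat_adjoint (W * A)) * (W * B)
      = W * B - W * (A * (?A' * B))"
    using W A B c unfolding 1[symmetric]
    by (subst minus_mult_distrib_mat[of _ N N _ _ m]) auto
  also have "\<dots> = W * (B - A * (?A' * B))"
    using W A B c by (subst mult_minus_distrib_mat[of _ N N _ m]) auto
  also have "B - A * (?A' * B) = (1\<^sub>m N - A * ?A') * B"
    by (simp only: minus_mult_distrib_mat[OF one_carrier_mat mult_carrier_mat[OF A c(2)] B]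
      left_mult_one_mat[OF B] assoc_mult_mat[OF A c(2) B])
  finally show ?thesis .
qed

section \<open>Matrices made of equally sized blocks\<close>

text \<open>
  \<open>F r c\<close> gives the entries of the \<open>n \<times> n\<close> block in block row \<open>r\<close> and block column \<open>c\<close>. Keeping the
  block index and the index inside a block as separate arguments makes products, adjoints and
  concatenations of blocks pointwise formulas.
\<close>

definition block_mat :: "nat \<Rightarrow> nat \<Rightarrow> nat \<Rightarrow> (nat \<Rightarrow> nat \<Rightarrow> nat \<Rightarrow> nat \<Rightarrow> complex) \<Rightarrow> complex mat" where
  "block_mat n R C F = mat (R * n) (C * n) (\<lambda>(i, j). F (i div n) (j div n) (i mod n) (j mod n))"

lemma block_mat_carrier [simp]: "block_mat n R C F \<in> carrier_mat (R * n) (C * n)"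
  unfolding block_mat_def by simp

lemma block_mat_dim [simp]:
  "dim_row (block_mat n R C F) = R * n" "dim_col (block_mat n R C F) = C * n"
  unfolding block_mat_def by simp_all

lemma block_mat_cong:
  assumes "\<And>r c i j. r < R \<Longrightarrow> c < C \<Longrightarrow> i < n \<Longrightarrow> j < n \<Longrightarrow> F r c i j = G r c i j"
  shows "block_mat n R C F = block_mat n R C G"
  unfolding block_mat_def
  by (intro cong_mat) (auto intro!: assms div_less_block mod_less_block)

lemma single_block_mat:
  "A \<in> carrier_mat n n \<Longrightarrow> A = block_mat n 1 1 (\<lambda>_ _ i j. A $$ (i, j))"
  unfolding block_mat_def by (intro eq_matI) auto

lemma block_mat_mult:
  "block_mat n R S F * block_mat n S C G =
     block_mat n R C (\<lambda>r c i j. \<Sum>s<S. \<Sum>k<n. F r s i k * G s c k j)"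
  by (intro eq_matI) (auto simp: block_mat_def scalar_prod_def sum_block intro!: sum.cong)

lemma block_mat_adjoint:
  "mat_adjoint (block_mat n R C F) = block_mat n C R (\<lambda>r c i j. cnj (F c r j i))"
  by (intro eq_matI) (auto simp: block_mat_def)

lemma block_mat_smult: "x \<cdot>\<^sub>m block_mat n R C F = block_mat n R C (\<lambda>r c i j. x * F r c i j)"
  by (intro eq_matI) (auto simp: block_mat_def)

lemma block_mat_uminus: "- block_mat n R C F = block_mat n R C (\<lambda>r c i j. - F r c i j)"
  by (intro eq_matI) (auto simp: block_mat_def)

lemma block_mat_zero: "0\<^sub>m (R * n) (C * n) = block_mat n R C (\<lambda>r c i j. 0)"
  by (intro eq_matI) (auto simp: block_mat_def)

lemma block_mat_minus:
  "block_mat n R C F - block_mat n R C G = block_mat n R C (\<lambda>r c i j. F r c i j - G r c i j)"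
  by (intro eq_matI) (auto simp: block_mat_def)

lemma block_mat_map: "map_mat f (block_mat n R C F) = block_mat n R C (\<lambda>r c i j. f (F r c i j))"
  by (intro eq_matI) (auto simp: block_mat_def)

lemma block_tail:
  assumes "R * n \<le> i" "i < (R + S) * (n::nat)"
  shows "R \<le> i div n" "(i - R * n) div n = i div n - R" "(i - R * n) mod n = i mod n"
    "i - R * n < S * n"
proof -
  obtain d where "i = R * n + d" using assms(1) le_Suc_ex by blast
  moreover have "0 < n" using assms by (cases n) auto
  ultimately show "R \<le> i div n" "(i - R * n) div n = i div n - R" "(i - R * n) mod n = i mod n"
    "i - R * n < S * n"
    using assms(2) by (auto simp: add_mult_distrib)
qed

lemma block_mat_append_rows:
  "block_mat n R C F @\<^sub>r block_mat n S C G =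
     block_mat n (R + S) C (\<lambda>r c. if r < R then F r c else G (r - R) c)"
  (is "?L = ?M")
proof (rule eq_matI)
  fix i j assume "i < dim_row ?M" "j < dim_col ?M"
  then have ij: "i < (R + S) * n" "j < C * n" by auto
  show "?L $$ (i, j) = ?M $$ (i, j)"
  proof (cases "i < R * n")
    case True
    then show ?thesis using ij
      by (simp add: append_rows_def block_mat_def div_less_block add_mult_distrib)
  next
    case False
    then show ?thesis using ij block_tail[of R n i S]
      by (simp add: append_rows_def block_mat_def add_mult_distrib)
  qed
qed (auto simp: append_rows_def add_mult_distrib)

lemma block_mat_append_cols:
  "block_mat n R C F @\<^sub>c block_mat n R D G =
     block_mat n R (C + D) (\<lambda>r c. if c < C then F r c else G r (c - C))"
  (is "?L = ?M")
proof (rule eq_matI)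
  fix i j assume "i < dim_row ?M" "j < dim_col ?M"
  then have ij: "i < R * n" "j < (C + D) * n" by auto
  show "?L $$ (i, j) = ?M $$ (i, j)"
  proof (cases "j < C * n")
    case True
    then show ?thesis using ij
      by (simp add: append_cols_def block_mat_def div_less_block add_mult_distrib)
  next
    case False
    then show ?thesis using ij block_tail[of C n j D]
      by (simp add: append_cols_def block_mat_def add_mult_distrib)
  qed
qed (auto simp: append_cols_def add_mult_distrib)

text \<open>
  All blocks are diagonal, so the matrix is a family of \<open>n\<close> independent \<open>R \<times> C\<close> matrices
  \<open>M 0, ..., M (n - 1)\<close>, interleaved. Sums, products and adjoints are formed
  separately for each index \<open>i < n\<close>, so that identities between such matrices are identities
  between small matrices.
\<close>

definition fibre_mat :: "nat \<Rightarrow> nat \<Rightarrow> nat \<Rightarrow> (nat \<Rightarrow> nat \<Rightarrow> nat \<Rightarrow> complex) \<Rightarrow> complex mat" where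
  "fibre_mat n R C M = block_mat n R C (\<lambda>r c i j. if i = j then M j r c else 0)"

lemma fibre_mat_carrier [simp]: "fibre_mat n R C M \<in> carrier_mat (R * n) (C * n)"
  unfolding fibre_mat_def by simp

lemma fibre_mat_cong:
  assumes "\<And>i r c. i < n \<Longrightarrow> r < R \<Longrightarrow> c < C \<Longrightarrow> M i r c = N i r c"
  shows "fibre_mat n R C M = fibre_mat n R C N"
  unfolding fibre_mat_def using assms by (intro block_mat_cong) auto

lemma block_mat_mult_fibre_mat:
  "block_mat n R S F * fibre_mat n S C M =
     block_mat n R C (\<lambda>r c i j. \<Sum>s<S. F r s i j * M j s c)"
  unfolding fibre_mat_def block_mat_mult
  by (intro block_mat_cong sum.cong refl) (simp add: if_distrib cong: if_cong)

lemma fibre_mat_mult: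
  "fibre_mat n R S M * fibre_mat n S C N = fibre_mat n R C (\<lambda>i r c. \<Sum>s<S. M i r s * N i s c)"
  unfolding fibre_mat_def[of n R S] block_mat_mult_fibre_mat
  unfolding fibre_mat_def by (intro block_mat_cong) auto

lemma fibre_mat_adjoint: "mat_adjoint (fibre_mat n R C M) = fibre_mat n C R (\<lambda>i r c. cnj (M i c r))"
  unfolding fibre_mat_def block_mat_adjoint by (intro block_mat_cong) auto

lemma fibre_mat_map:
  "f 0 = 0 \<Longrightarrow> map_mat f (fibre_mat n R C M) = fibre_mat n R C (\<lambda>i r c. f (M i r c))"
  unfolding fibre_mat_def block_mat_map by (intro block_mat_cong) auto

lemma fibre_mat_minus:
  "fibre_mat n R C M - fibre_mat n R C N = fibre_mat n R C (\<lambda>i r c. M i r c - N i r c)"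
  unfolding fibre_mat_def block_mat_minus by (intro block_mat_cong) auto

lemma fibre_mat_append_rows:
  "fibre_mat n R C M @\<^sub>r fibre_mat n S C N =
     fibre_mat n (R + S) C (\<lambda>i r c. if r < R then M i r c else N i (r - R) c)"
  unfolding fibre_mat_def block_mat_append_rows by (intro block_mat_cong) auto

lemma one_fibre_mat: "1\<^sub>m (R * n) = fibre_mat n R R (\<lambda>i r c. if r = c then 1 else 0)"
  unfolding fibre_mat_def block_mat_def
  by (rule eq_matI) (auto, metis div_mod_decomp)

lemma mat_diag_fibre_mat: "mat_diag n f = fibre_mat n 1 1 (\<lambda>i _ _. f i)"
  unfolding fibre_mat_def block_mat_def mat_diag_def by (rule eq_matI) auto

lemma fibre_mat_diagonal:
  assumes "\<And>i r c. i < n \<Longrightarrow> r < R \<Longrightarrow> c < C \<Longrightarrow> r \<noteq> c \<Longrightarrow> M i r c = 0"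
  shows "diagonal_mat (fibre_mat n R C M)"
  unfolding diagonal_mat_def fibre_mat_def block_mat_def
  by (auto intro!: assms div_less_block mod_less_block, metis div_mod_decomp)

lemma fibre_mat_diag_index:
  assumes "i < R * n" "i < C * n"
  shows "fibre_mat n R C M $$ (i, i) = M (i mod n) (i div n) (i div n)"
  using assms unfolding fibre_mat_def block_mat_def by simp

lemma one_kronecker_block_mat:
  assumes "A \<in> carrier_mat n n"
  shows "1\<^sub>m R \<otimes>\<^sub>K A = block_mat n R R (\<lambda>r c i j. if r = c then A $$ (i, j) else 0)"
  using assms unfolding kronecker_def block_mat_def
  by (intro eq_matI) (auto simp: div_less_block)

lemma one_kronecker_mult_fibre_mat:
  assumes "A \<in> carrier_mat n n"
  shows "(1\<^sub>m R \<otimes>\<^sub>K A) * fibre_mat n R C M = block_mat n R C (\<lambda>r c i j. A $$ (i, j) * M j r c)"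
  unfolding one_kronecker_block_mat[OF assms] block_mat_mult_fibre_mat
  by (intro block_mat_cong) (auto simp: if_distrib[of "\<lambda>x. x * _"] cong: if_cong)

lemma four_block_mat_append:
  assumes "A \<in> carrier_mat a c" "B \<in> carrier_mat a d" "C \<in> carrier_mat b c" "D \<in> carrier_mat b d"
  shows "four_block_mat A B C D = (A @\<^sub>c B) @\<^sub>r (C @\<^sub>c D)"
  using assms unfolding append_cols_def append_rows_def by (intro eq_matI) auto

lemma fibre_mat_append_cols:
  "fibre_mat n R C M @\<^sub>c fibre_mat n R D N =
     fibre_mat n R (C + D) (\<lambda>i r c. if c < C then M i r c else N i r (c - C))"
  unfolding fibre_mat_def block_mat_append_cols by (intro block_mat_cong) auto

lemma zero_fibre_mat: "0\<^sub>m (R * n) (C * n) = fibre_mat n R C (\<lambda>_ _ _. 0)"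
  unfolding fibre_mat_def block_mat_zero by simp

text \<open>
  The shape in which \<open>diag_block_mat\<close> unfolds, step by step, into a block diagonal matrix.
\<close>

lemma diag_block_fibre_mat:
  "four_block_mat (fibre_mat n R R M) (0\<^sub>m (R * n) (S * n)) (0\<^sub>m (S * n) (R * n)) (fibre_mat n S S N) =
     fibre_mat n (R + S) (R + S) (\<lambda>i r c. if r < R \<and> c < R then M i r c
       else if \<not> r < R \<and> \<not> c < R then N i (r - R) (c - R) else 0)"
  by (subst four_block_mat_append[of _ "R * n" "R * n" _ "S * n" _ "S * n"])
    (auto simp: zero_fibre_mat fibre_mat_append_cols fibre_mat_append_rows intro!: fibre_mat_cong)

lemma one_kronecker_append_cols:
  assumes "A \<in> carrier_mat n n"
  shows "(1\<^sub>m R \<otimes>\<^sub>K A) * fibre_mat n R C M @\<^sub>c (1\<^sub>m R \<otimes>\<^sub>K A) * fibre_mat n R D N =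
     (1\<^sub>m R \<otimes>\<^sub>K A) * fibre_mat n R (C + D) (\<lambda>i r c. if c < C then M i r c else N i r (c - C))"
  unfolding one_kronecker_mult_fibre_mat[OF assms] block_mat_append_cols
  by (intro block_mat_cong) auto

section \<open>Functions of diagonal matrices\<close>

lemma mat_diag_smult: "x \<cdot>\<^sub>m mat_diag n f = mat_diag n (\<lambda>i. x * f i :: complex)"
  unfolding mat_diag_def by (intro eq_matI) auto

lemma mat_diag_add: "mat_diag n f + mat_diag n g = mat_diag n (\<lambda>i. f i + g i :: complex)"
  unfolding mat_diag_def by (intro eq_matI) auto

lemma mat_diag_minus: "mat_diag n f - mat_diag n g = mat_diag n (\<lambda>i. f i - g i :: complex)"
  unfolding mat_diag_def by (intro eq_matI) auto

lemma mat_diag_adjoint: "mat_adjoint (mat_diag n f) = mat_diag n (\<lambda>i. cnj (f i))"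
  unfolding mat_diag_def by (intro eq_matI) auto

lemma diag_inverse_mat_diag: "diag_inverse (mat_diag n f) = mat_diag n (\<lambda>i. inverse (f i))"
  unfolding mat_diag_def diag_inverse_def by (intro eq_matI) auto

lemma diag_sqrt_mat_diag: "diag_sqrt (mat_diag n f) = mat_diag n (\<lambda>i. csqrt (f i))"
  unfolding mat_diag_def diag_sqrt_def by (intro eq_matI) auto

lemma diag_inv_sqrt_mat_diag:
  "diag_inv_sqrt (mat_diag n f) = mat_diag n (\<lambda>i. inverse (csqrt (f i)))"
  by (simp add: diag_inv_sqrt_def diag_inverse_mat_diag diag_sqrt_mat_diag)

section \<open>Bloch modes diagonalize the one-dimensional differences\<close>

text \<open>
  For \<open>i = 0, ..., m - 1\<close> these are the \<open>m\<close>-th roots of the phase that a Bloch wave picks up along \<open>v\<close>.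
\<close>

definition bloch_root :: "real vec \<Rightarrow> real vec \<Rightarrow> nat \<Rightarrow> nat \<Rightarrow> complex" where
  "bloch_root k v m i = exp (theta_idx m i + theta_vec k v m)"

lemma bloch_root_cis: "bloch_root k v m i = cis (2 * pi * real i / real m) * cis (2 * pi * (k \<bullet> v) / real m)"
  by (simp add: bloch_root_def theta_idx_def theta_vec_def exp_add cis_conv_exp)

lemma bloch_root_power:
  assumes "m > 0"
  shows "bloch_root k v m i ^ m = exp (\<i> * of_real (2 * pi * (k \<bullet> v)))"
proof -
  have "cis (2 * pi * real i) = 1" using cis_multiple_2pi[of "real i"] by simp
  then show ?thesis using assms
    by (simp add: bloch_root_cis power_mult_distrib DeMoivre) (simp add: cis_conv_exp)
qed

text \<open>
  The two phase factors of \<open>D\<close> and \<open>U\<close> combine into powers of one number, so the product is a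
  Vandermonde matrix in the Bloch roots.
\<close>

lemma D_mult_U: "D_mat k v m * U_mat m = mat m m (\<lambda>(j, i). bloch_root k v m i ^ j)"
  unfolding D_mat_def U_mat_def
  by (subst mat_diag_mult_left[of _ m m])
    (auto intro!: cong_mat simp: bloch_root_def exp_of_nat_mult[symmetric] exp_add[symmetric] algebra_simps)

text \<open>
  On a geometric sequence the forward difference acts as multiplication by \<open>z - 1\<close>; in the last row
  the corner entry of \<open>K\<close> takes over the role of \<open>z ^ m\<close>, because \<open>z\<close> is an \<open>m\<close>-th root of that entry.
\<close>

lemma K_mult_DU:
  assumes "m \<ge> 2"
  shows "K_mat k v m * (D_mat k v m * U_mat m) = (D_mat k v m * U_mat m) * Lambda_mat k v m"
proof -
  let ?z = "bloch_root k v m"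
  let ?c = "exp (\<i> * of_real (2 * pi * (k \<bullet> v))) :: complex"
  let ?V = "mat m m (\<lambda>(j, i). ?z i ^ j)"
  have "K_mat k v m * ?V = ?V * Lambda_mat k v m"
  proof (rule eq_matI)
    fix j i assume "j < dim_row (?V * Lambda_mat k v m)" "i < dim_col (?V * Lambda_mat k v m)"
    then have ji: "j < m" "i < m" by (auto simp: Lambda_mat_def mat_diag_def)
    have "(K_mat k v m * ?V) $$ (j, i) = (\<Sum>l<m. (if l = j then -1 else if l = j + 1 then 1
        else if j = m - 1 \<and> l = 0 then ?c else 0) * ?z i ^ l)"
      using ji by (simp add: K_mat_def scalar_prod_def atLeast0LessThan)
    \<comment> \<open>The three kinds of nonzero entries lie at different positions because \<open>m \<ge> 2\<close>.\<close>
    also have "\<dots> = (\<Sum>l<m. (if l = j then - (?z i ^ l) else 0) + (if l = j + 1 then ?z i ^ l else 0)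
        + (if l = 0 then (if j = m - 1 then ?c else 0) else 0))"
      using assms by (intro sum.cong) auto
    also have "\<dots> = - (?z i ^ j) + (if j + 1 < m then ?z i ^ (j + 1) else 0) + (if j = m - 1 then ?c else 0)"
      using ji by (simp add: sum.distrib)
    also have "\<dots> = ?z i ^ j * (?z i - 1)"
    proof (cases "j + 1 < m")
      case False
      then have "m = Suc j" using ji by simp
      moreover have "?z i ^ m = ?c" using assms by (intro bloch_root_power) simp
      ultimately show ?thesis by (simp add: algebra_simps)
    qed (auto simp: algebra_simps)
    also have "\<dots> = (?V * Lambda_mat k v m) $$ (j, i)"
      unfolding Lambda_mat_def using ji by (subst mat_diag_mult_right[of _ m m]) (auto simp: bloch_root_def)
    finally show "(K_mat k v m * ?V) $$ (j, i) = (?V * Lambda_mat k v m) $$ (j, i)" .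
  qed (auto simp: K_mat_def Lambda_mat_def mat_diag_def)
  then show ?thesis by (simp add: D_mult_U)
qed

text \<open>
  The common phase drops out of the inner products, which are then geometric sums over powers of an
  \<open>m\<close>-th root of unity.
\<close>

lemma DU_orthogonal:
  "mat_adjoint (D_mat k v m * U_mat m) * (D_mat k v m * U_mat m) = of_nat m \<cdot>\<^sub>m 1\<^sub>m m"
proof -
  let ?z = "bloch_root k v m"
  let ?V = "mat m m (\<lambda>(j, i). ?z i ^ j)"
  have "mat_adjoint ?V * ?V = of_nat m \<cdot>\<^sub>m 1\<^sub>m m"
  proof (rule eq_matI)
    fix i l assume "i < dim_row (of_nat m \<cdot>\<^sub>m 1\<^sub>m m :: complex mat)" "l < dim_col (of_nat m \<cdot>\<^sub>m 1\<^sub>m m :: complex mat)"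
    then have il: "i < m" "l < m" by auto
    \<comment> \<open>The Bloch roots are the roots of unity \<open>w i\<close> times a common phase.\<close>
    define w where "w i = cis (2 * pi * real i / real m)" for i
    define u where "u = cnj (w i) * w l"
    have m: "m > 0" using il by simp
    have norm_w: "cnj (w i) * w i = 1" for i by (simp add: w_def cis_cnj cis_mult)
    have zz: "cnj (?z i) * ?z l = u"
    proof -
      have "cnj (?z i) * ?z l = u * (cnj (cis (2 * pi * (k \<bullet> v) / m)) * cis (2 * pi * (k \<bullet> v) / m))"
        by (simp add: u_def w_def bloch_root_cis)
      then show ?thesis by (simp add: cis_cnj cis_mult)
    qed
    have "w j ^ m = 1" for j
      using m cis_multiple_2pi[of "real j"] by (simp add: w_def DeMoivre)
    then have um: "u ^ m = 1" unfolding u_def by (simp add: power_mult_distrib flip: complex_cnj_power)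
    have u1: "u = 1 \<longleftrightarrow> i = l"
    proof
      assume "u = 1"
      then have "w i * (cnj (w i) * w l) = w i" by (simp add: u_def)
      then have "w l = w i" using norm_w[of i] by (simp add: mult.assoc[symmetric] mult.commute[of "w i"])
      moreover have "inj_on w {..<m}"
        using bij_betw_roots_unity[OF m] by (simp add: bij_betw_def w_def[abs_def])
      ultimately show "i = l" using il by (auto dest: inj_onD)
    qed (simp add: u_def norm_w)
    have "(mat_adjoint ?V * ?V) $$ (i, l) = (\<Sum>j<m. u ^ j)"
      using il by (simp add: scalar_prod_def atLeast0LessThan zz flip: power_mult_distrib)
    also have "\<dots> = (if i = l then of_nat m else 0)"
      using u1 um geometric_sum[of u m] by auto
    finally show "(mat_adjoint ?V * ?V) $$ (i, l) = (of_nat m \<cdot>\<^sub>m 1\<^sub>m m) $$ (i, l)"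
      using il by simp
  qed auto
  then show ?thesis by (simp add: D_mult_U)
qed

text \<open>
  The argument of the root is \<open>2 \<pi> (i + k \<bullet> v) / m\<close>, strictly between \<open>0\<close> and \<open>2 \<pi>\<close>.
\<close>

lemma bloch_root_neq_1:
  assumes "m > 0" "i < m" "0 < k \<bullet> v" "k \<bullet> v < 1"
  shows "bloch_root k v m i \<noteq> 1"
proof
  let ?x = "(real i + k \<bullet> v) / real m"
  assume "bloch_root k v m i = 1"
  then have "cis (2 * pi * ?x) = 1"
    by (simp add: bloch_root_cis cis_mult add_divide_distrib distrib_left)
  then have "cos (2 * pi * ?x) = 1" by (metis cis.simps(1) one_complex.simps(1))
  then obtain t :: int where "2 * pi * ?x = t * 2 * pi" by (auto simp: cos_one_2pi_int)
  then have "2 * pi * ?x = 2 * pi * t" by simp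
  then have "?x = t" by (subst (asm) mult_cancel_left) simp
  moreover have "0 < ?x" "?x < 1" using assms by auto
  ultimately have "0 < t" "t < 1" by simp_all
  then show False by simp
qed

lemma norm_bloch_root: "cmod (bloch_root k v m i) = 1"
  by (simp add: bloch_root_cis norm_mult)

lemma DU_carrier: "D_mat k v m * U_mat m \<in> carrier_mat m m"
  by (simp add: D_mult_U)

lemma T_mat_eq:
  "T_mat n1 n2 n3 a k = of_real (1 / sqrt (real (n1 * n2 * n3))) \<cdot>\<^sub>m
     ((D_mat k (lattice_vec a 2) n3 * U_mat n3) \<otimes>\<^sub>K (D_mat k (lattice_vec a 1) n2 * U_mat n2)
        \<otimes>\<^sub>K (D_mat k (lattice_vec a 0) n1 * U_mat n1))"
proof -
  have D: "D_mat k v m \<in> carrier_mat m m" and U: "U_mat m \<in> carrier_mat m m" for v m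
    by (auto simp: D_mat_def U_mat_def)
  show ?thesis
    unfolding T_mat_def grid_size_def
    by (subst kronecker_mult[OF D U kronecker_carrier[OF D D] kronecker_carrier[OF U U]],
        subst kronecker_mult[OF D U D U]) simp
qed

lemma T_mat_carrier [simp]: "T_mat n1 n2 n3 a k \<in> carrier_mat (n1 * n2 * n3) (n1 * n2 * n3)"
  unfolding T_mat_eq by (auto simp: D_mult_U mult_ac)

text \<open>
  The three one-dimensional factors have orthogonal columns of squared norms \<open>n3\<close>, \<open>n2\<close> and \<open>n1\<close>; the
  prefactor of \<open>T\<close> normalizes the product.
\<close>

lemma T_mat_isometry:
  assumes "n1 > 0" "n2 > 0" "n3 > 0"
  shows "mat_adjoint (T_mat n1 n2 n3 a k) * T_mat n1 n2 n3 a k = 1\<^sub>m (n1 * n2 * n3)"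
proof -
  define X where "X l m = D_mat k (lattice_vec a l) m * U_mat m" for l m
  have X: "X l m \<in> carrier_mat m m" for l m unfolding X_def by (rule DU_carrier)
  have X': "mat_adjoint (X l m) \<in> carrier_mat m m" for l m using X by simp
  have XX: "mat_adjoint (X l m) * X l m = of_nat m \<cdot>\<^sub>m 1\<^sub>m m" for l m
    unfolding X_def by (rule DU_orthogonal)
  let ?s = "of_real (1 / sqrt (real (n1 * n2 * n3))) :: complex"
  let ?Y = "X 2 n3 \<otimes>\<^sub>K X 1 n2 \<otimes>\<^sub>K X 0 n1"
  have Y: "?Y \<in> carrier_mat (n3 * (n2 * n1)) (n3 * (n2 * n1))"
    by (intro kronecker_carrier X)
  have T: "T_mat n1 n2 n3 a k = ?s \<cdot>\<^sub>m ?Y" unfolding T_mat_eq X_def ..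
  have adj: "mat_adjoint (?s \<cdot>\<^sub>m ?Y) = ?s \<cdot>\<^sub>m mat_adjoint ?Y"
    by (intro eq_matI) auto
  have "mat_adjoint ?Y * ?Y = of_nat (n1 * n2 * n3) \<cdot>\<^sub>m 1\<^sub>m (n1 * n2 * n3)"
    unfolding kronecker_adjoint
    by (subst kronecker_mult[OF X' X kronecker_carrier[OF X' X'] kronecker_carrier[OF X X]],
        subst kronecker_mult[OF X' X X' X])
      (simp add: XX smult_kronecker one_kronecker_one mult_ac)
  then have "mat_adjoint (T_mat n1 n2 n3 a k) * T_mat n1 n2 n3 a k
      = ?s \<cdot>\<^sub>m (?s \<cdot>\<^sub>m (of_nat (n1 * n2 * n3) \<cdot>\<^sub>m 1\<^sub>m (n1 * n2 * n3)))"
    unfolding T adj using Y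
    by (subst mult_smult_assoc_mat[of _ "n3 * (n2 * n1)" "n3 * (n2 * n1)" _ "n3 * (n2 * n1)"], simp, simp,
        subst mult_smult_distrib[of _ "n3 * (n2 * n1)" "n3 * (n2 * n1)" _ "n3 * (n2 * n1)"]) auto
  also have "\<dots> = (?s * ?s * of_nat (n1 * n2 * n3)) \<cdot>\<^sub>m 1\<^sub>m (n1 * n2 * n3)"
    by (intro eq_matI) auto
  also have "?s * ?s * of_nat (n1 * n2 * n3) = of_real (1 / sqrt (real (n1 * n2 * n3)) * (1 / sqrt (real (n1 * n2 * n3))) * real (n1 * n2 * n3))"
    by (simp only: of_real_mult of_real_of_nat_eq)
  also have "1 / sqrt (real (n1 * n2 * n3)) * (1 / sqrt (real (n1 * n2 * n3))) * real (n1 * n2 * n3) = 1"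
    using assms by (simp del: of_nat_mult)
  finally show ?thesis by (simp add: one_smult)
qed

lemma K_carrier: "K_mat k v m \<in> carrier_mat m m" by (simp add: K_mat_def)
lemma Lambda_mat_carrier: "Lambda_mat k v m \<in> carrier_mat m m" by (simp add: Lambda_mat_def)

text \<open>
  An eigenvector equation in each of the three factors gives one for the Kronecker products. It is
  used with identities in two of the factors, where the equation is trivial.
\<close>

lemma smult_kronecker_intertwine:
  assumes carrier: "A3 \<in> carrier_mat n3 n3" "A2 \<in> carrier_mat n2 n2" "A1 \<in> carrier_mat n1 n1"
    "X3 \<in> carrier_mat n3 n3" "X2 \<in> carrier_mat n2 n2" "X1 \<in> carrier_mat n1 n1"
    "B3 \<in> carrier_mat n3 n3" "B2 \<in> carrier_mat n2 n2" "B1 \<in> carrier_mat n1 n1"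
    and eq: "A3 * X3 = X3 * B3" "A2 * X2 = X2 * B2" "A1 * X1 = X1 * B1"
  shows "(c \<cdot>\<^sub>m (A3 \<otimes>\<^sub>K A2 \<otimes>\<^sub>K A1)) * (s \<cdot>\<^sub>m (X3 \<otimes>\<^sub>K X2 \<otimes>\<^sub>K X1))
     = (s \<cdot>\<^sub>m (X3 \<otimes>\<^sub>K X2 \<otimes>\<^sub>K X1)) * (c \<cdot>\<^sub>m (B3 \<otimes>\<^sub>K B2 \<otimes>\<^sub>K B1))"
proof -
  let ?n = "n3 * (n2 * n1)"
  have *: "(x \<cdot>\<^sub>m M) * (y \<cdot>\<^sub>m N) = (x * y) \<cdot>\<^sub>m (M * N)"
    if "M \<in> carrier_mat ?n ?n" "N \<in> carrier_mat ?n ?n" for x y :: complex and M N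
    using that by (intro eq_matI) auto
  have 3: "(M3 \<otimes>\<^sub>K M2 \<otimes>\<^sub>K M1) * (N3 \<otimes>\<^sub>K N2 \<otimes>\<^sub>K N1) = (M3 * N3) \<otimes>\<^sub>K (M2 * N2) \<otimes>\<^sub>K (M1 * N1)"
    if "M3 \<in> carrier_mat n3 n3" "M2 \<in> carrier_mat n2 n2" "M1 \<in> carrier_mat n1 n1"
      "N3 \<in> carrier_mat n3 n3" "N2 \<in> carrier_mat n2 n2" "N1 \<in> carrier_mat n1 n1" for M3 M2 M1 N3 N2 N1
    using that by (simp add: kronecker_mult[OF that(1,4) kronecker_carrier kronecker_carrier] kronecker_mult[OF that(2,5,3,6)])
  show ?thesis
    using carrier by (simp add: * 3 kronecker_carrier eq mult.commute[of c s])
qed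

lemma C_mult_T:
  assumes "n1 \<ge> 2" "n2 \<ge> 2" "n3 \<ge> 2"
  shows "C1 n1 n2 n3 dx a k * T_mat n1 n2 n3 a k = T_mat n1 n2 n3 a k * Lambda1 n1 n2 n3 dx a k"
    and "C2 n1 n2 n3 dy a k * T_mat n1 n2 n3 a k = T_mat n1 n2 n3 a k * Lambda2 n1 n2 n3 dy a k"
    and "C3 n1 n2 n3 dz a k * T_mat n1 n2 n3 a k = T_mat n1 n2 n3 a k * Lambda3 n1 n2 n3 dz a k"
  unfolding C1_def C2_def C3_def Lambda1_def Lambda2_def Lambda3_def T_mat_eq
  using assms
  by (auto intro!: smult_kronecker_intertwine K_mult_DU DU_carrier K_carrier Lambda_mat_carrier)
    (simp_all add: D_mult_U)

section \<open>Singular frames of a single cross product\<close>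

text \<open>
  Vectors of \<open>\<complex>\<^sup>3\<close> are functions of which only the values at \<open>0, 1, 2\<close> matter; the cyclic indices give
  all three components of the cross product by one formula.
\<close>

definition cross :: "(nat \<Rightarrow> complex) \<Rightarrow> (nat \<Rightarrow> complex) \<Rightarrow> nat \<Rightarrow> complex" where
  "cross u v r = u ((r + 1) mod 3) * v ((r + 2) mod 3) - u ((r + 2) mod 3) * v ((r + 1) mod 3)"

definition hinner :: "(nat \<Rightarrow> complex) \<Rightarrow> (nat \<Rightarrow> complex) \<Rightarrow> complex" where
  "hinner u v = (\<Sum>s<3. cnj (u s) * v s)"

definition conj_vec :: "(nat \<Rightarrow> complex) \<Rightarrow> nat \<Rightarrow> complex" where
  "conj_vec u r = cnj (u r)"

definition cross_mat :: "(nat \<Rightarrow> complex) \<Rightarrow> nat \<Rightarrow> nat \<Rightarrow> complex" where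
  "cross_mat u r c = cross u (\<lambda>s. if s = c then 1 else 0) r"

lemma sum3: "(\<Sum>s<3. f s) = f 0 + f 1 + f (2::nat)" for f :: "nat \<Rightarrow> complex"
  by (simp add: eval_nat_numeral)

lemma less3_cases: "(r::nat) < 3 \<Longrightarrow> r = 0 \<or> r = 1 \<or> r = 2" by auto

lemma cross_simps:
  "cross u v 0 = u 1 * v 2 - u 2 * v 1"
  "cross u v 1 = u 2 * v 0 - u 0 * v 2" "cross u v (Suc 0) = u 2 * v 0 - u 0 * v 2"
  "cross u v 2 = u 0 * v 1 - u 1 * v 0"
  by (simp_all add: cross_def numeral_2_eq_2)

lemma cross_mat_apply:
  assumes "r < 3" shows "(\<Sum>s<3. cross_mat u r s * v s) = cross u v r"
  using less3_cases[OF assms] by (auto simp: sum3 cross_mat_def cross_simps)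

lemma cross_mat_adjoint_apply:
  assumes "r < 3" shows "(\<Sum>s<3. cnj (cross_mat u s r) * v s) = - cross (conj_vec u) v r"
  using less3_cases[OF assms] by (auto simp: sum3 cross_mat_def cross_simps conj_vec_def)

lemma hinner_cross_self: "hinner u (cross (conj_vec u) v) = 0"
  by (simp add: hinner_def sum3 cross_simps conj_vec_def algebra_simps)

lemma hinner_cross_real:
  assumes "\<And>r. cnj (w r) = w r"
  shows "hinner w (cross u w) = 0"
  using assms by (simp add: hinner_def sum3 cross_simps algebra_simps)

text \<open>
  Lagrange's identity for the Hermitian inner product.
\<close>

lemma hinner_cross_cross:
  "hinner (cross u v) (cross u v) = hinner u u * hinner v v - cnj (hinner u v) * hinner u v"
  by (simp add: hinner_def sum3 cross_simps algebra_simps)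

text \<open>
  The expansion \<open>u \<times> (v \<times> w) = v (u \<cdot> w) - (u \<cdot> v) w\<close> with \<open>v = conj_vec u\<close>, where the bilinear
  products \<open>u \<cdot> w\<close> and \<open>u \<cdot> v\<close> are written as Hermitian ones.
\<close>

lemma cross_cross_conj_vec:
  assumes "r < 3"
  shows "cross u (cross (conj_vec u) w) r = conj_vec u r * hinner (conj_vec u) w - hinner u u * w r"
  using less3_cases[OF assms] by (auto simp: hinner_def sum3 cross_simps conj_vec_def algebra_simps)

lemma norm_cross_conj_vec:
  assumes "\<And>r. cnj (w r) = w r"
  shows "hinner (cross (conj_vec u) w) (cross (conj_vec u) w) = hinner (cross u w) (cross u w)"
  using assms by (simp add: hinner_def sum3 cross_simps conj_vec_def algebra_simps)

lemma hinner_commute: "hinner v u = cnj (hinner u v)"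
  by (simp add: hinner_def mult.commute)

lemma hinner_diff_right: "hinner u (\<lambda>r. v r - v' r) = hinner u v - hinner u v'"
  and hinner_diff_left: "hinner (\<lambda>r. v r - v' r) u = hinner v u - hinner v' u"
  and hinner_mult_right: "hinner u (\<lambda>r. v r * x) = hinner u v * x"
  and hinner_mult_left: "hinner (\<lambda>r. v r * x) u = hinner v u * cnj x"
  by (simp_all add: hinner_def sum3 algebra_simps)

lemmas hinner_linear = hinner_diff_right hinner_diff_left hinner_mult_right hinner_mult_left

lemma hinner_self: "hinner u u = of_real (\<Sum>s<3. (cmod (u s))\<^sup>2)"
  by (simp add: hinner_def mult.commute flip: complex_norm_square)

text \<open>
  The right singular vectors of \<open>v \<mapsto> l \<times> v\<close>: the part of \<open>w\<close> orthogonal to \<open>l\<close>, the vector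
  \<open>- conj_vec l \<times> w\<close> orthogonal to both, and the kernel vector \<open>l\<close>. They have norm \<open>1\<close> for
  \<open>\<sigma> = |l|\<close> and \<open>\<rho> = |l \<times> w|\<close>. The column index comes before the component, so that fixing it gives
  a vector.
\<close>

definition right_frame :: "(nat \<Rightarrow> complex) \<Rightarrow> (nat \<Rightarrow> complex) \<Rightarrow> real \<Rightarrow> real \<Rightarrow> nat \<Rightarrow> nat \<Rightarrow> complex" where
  "right_frame l w \<sigma> \<rho> c r =
    (if c = 0 then (w r - l r * (hinner l w / of_real (\<sigma>\<^sup>2))) * of_real (\<sigma> / \<rho>)
     else if c = 1 then cross (conj_vec l) w r * of_real (- 1 / \<rho>)
     else l r * of_real (1 / \<sigma>))"

definition left_frame :: "(nat \<Rightarrow> complex) \<Rightarrow> (nat \<Rightarrow> complex) \<Rightarrow> real \<Rightarrow> real \<Rightarrow> nat \<Rightarrow> nat \<Rightarrow> complex" where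
  "left_frame l w \<sigma> \<rho> c r =
    (if c = 0 then cross l w r * of_real (1 / \<rho>)
     else if c = 1 then (w r - conj_vec l r * (hinner (conj_vec l) w / of_real (\<sigma>\<^sup>2))) * of_real (\<sigma> / \<rho>)
     else conj_vec l r * of_real (1 / \<sigma>))"

lemma right_frame_orthonormal:
  assumes w: "\<And>r. cnj (w r) = w r"
    and \<sigma>: "\<sigma> > 0" "hinner l l = of_real (\<sigma>\<^sup>2)"
    and \<rho>: "\<rho> > 0" "hinner (cross l w) (cross l w) = of_real (\<rho>\<^sup>2)"
    and cd: "c < 3" "d < 3"
  shows "hinner (right_frame l w \<sigma> \<rho> c) (right_frame l w \<sigma> \<rho> d) = (if c = d then 1 else 0)"
proof -
  let ?f = "right_frame l w \<sigma> \<rho>"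
  let ?s = "of_real \<sigma> :: complex" and ?p = "of_real \<rho> :: complex"
  have f: "?f 0 = (\<lambda>r. (w r - l r * (hinner l w / ?s\<^sup>2)) * (?s / ?p))"
    "?f 1 = (\<lambda>r. cross (conj_vec l) w r * (- 1 / ?p))" "?f 2 = (\<lambda>r. l r * (1 / ?s))"
    by (auto simp: right_frame_def fun_eq_iff)
  have nz: "?s \<noteq> 0" "?p \<noteq> 0" using \<sigma> \<rho> by auto
  have ll: "hinner l l = ?s\<^sup>2" using \<sigma> by simp
  have pp: "hinner (cross (conj_vec l) w) (cross (conj_vec l) w) = ?p\<^sup>2"
    using norm_cross_conj_vec[OF w] \<rho> by simp
  have lag: "?p\<^sup>2 = ?s\<^sup>2 * hinner w w - cnj (hinner l w) * hinner l w"
    using hinner_cross_cross[of l w] \<rho> ll by simp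
  have lc: "hinner l (cross (conj_vec l) w) = 0" by (rule hinner_cross_self)
  have wc: "hinner w (cross (conj_vec l) w) = 0" by (rule hinner_cross_real[OF w])
  have "hinner (?f 0) (?f 0) = (?s\<^sup>2 * hinner w w - cnj (hinner l w) * hinner l w) / ?p\<^sup>2"
    unfolding f hinner_linear ll hinner_commute[of w l] using nz
    by (simp add: field_simps power2_eq_square)
  then have "hinner (?f 0) (?f 0) = 1" using nz by (simp add: lag[symmetric])
  moreover have "hinner (?f 0) (?f 1) = 0" unfolding f hinner_linear lc wc by simp
  moreover have "hinner (?f 2) (?f 0) = 0" unfolding f hinner_linear ll using nz by simp
  moreover have "hinner (?f 2) (?f 1) = 0" unfolding f hinner_linear lc by simp
  moreover have "hinner (?f 1) (?f 1) = 1" unfolding f hinner_linear pp using nz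
    by (simp add: power2_eq_square)
  moreover have "hinner (?f 2) (?f 2) = 1" unfolding f hinner_linear ll using nz
    by (simp add: power2_eq_square)
  ultimately show ?thesis
    using less3_cases[OF cd(1)] less3_cases[OF cd(2)]
      hinner_commute[of "?f 1" "?f 0"] hinner_commute[of "?f 0" "?f 2"] hinner_commute[of "?f 1" "?f 2"]
    by auto
qed

text \<open>
  Conjugating \<open>l\<close> exchanges the two frames, up to a sign and a transposition of the first two columns,
  so the orthonormality of the right frame carries over.
\<close>

lemma left_frame_orthonormal:
  assumes w: "\<And>r. cnj (w r) = w r"
    and \<sigma>: "\<sigma> > 0" "hinner l l = of_real (\<sigma>\<^sup>2)"
    and \<rho>: "\<rho> > 0" "hinner (cross l w) (cross l w) = of_real (\<rho>\<^sup>2)"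
    and cd: "c < 3" "d < 3"
  shows "hinner (left_frame l w \<sigma> \<rho> c) (left_frame l w \<sigma> \<rho> d) = (if c = d then 1 else 0)"
proof -
  \<comment> \<open>The transposition and the sign relating the left frame of \<open>l\<close> to the right frame of its conjugate.\<close>
  define \<pi> where "\<pi> c = (if c = 0 then 1 else if c = 1 then 0 else 2::nat)" for c :: nat
  define \<epsilon> :: "nat \<Rightarrow> complex" where "\<epsilon> c = (if c = 0 then - 1 else 1)" for c
  have cc: "conj_vec (conj_vec l) = l" by (simp add: conj_vec_def fun_eq_iff)
  have eq: "left_frame l w \<sigma> \<rho> c = (\<lambda>r. right_frame (conj_vec l) w \<sigma> \<rho> (\<pi> c) r * \<epsilon> c)" for c
    by (auto simp: left_frame_def right_frame_def \<pi>_def \<epsilon>_def cc fun_eq_iff)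
  have "hinner (conj_vec l) (conj_vec l) = of_real (\<sigma>\<^sup>2)"
    using \<sigma> by (simp add: hinner_def conj_vec_def mult.commute)
  moreover have "hinner (cross (conj_vec l) w) (cross (conj_vec l) w) = of_real (\<rho>\<^sup>2)"
    using norm_cross_conj_vec[OF w] \<rho> by simp
  moreover have "\<pi> c < 3" "\<pi> d < 3" by (auto simp: \<pi>_def)
  ultimately have "hinner (right_frame (conj_vec l) w \<sigma> \<rho> (\<pi> c)) (right_frame (conj_vec l) w \<sigma> \<rho> (\<pi> d))
      = (if \<pi> c = \<pi> d then 1 else 0)"
    using w \<sigma>(1) \<rho>(1) by (intro right_frame_orthonormal) auto
  then show ?thesis unfolding eq hinner_linear
    using less3_cases[OF cd(1)] less3_cases[OF cd(2)] by (auto simp: \<pi>_def \<epsilon>_def)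
qed

text \<open>
  The columns of the two frames are pairs of singular vectors for the singular values \<open>\<sigma>, \<sigma>, 0\<close>.
\<close>

lemma cross_right_frame:
  assumes \<sigma>: "\<sigma> > 0" "hinner l l = of_real (\<sigma>\<^sup>2)" and \<rho>: "\<rho> > 0" and r: "r < 3"
  shows "cross l (right_frame l w \<sigma> \<rho> 0) r = left_frame l w \<sigma> \<rho> 0 r * of_real \<sigma>"
    "cross l (right_frame l w \<sigma> \<rho> 1) r = left_frame l w \<sigma> \<rho> 1 r * of_real \<sigma>"
    "cross l (right_frame l w \<sigma> \<rho> 2) r = 0"
proof -
  have lin: "cross l (\<lambda>r. x r * y) r = cross l x r * y" for x y
    by (simp add: cross_def algebra_simps)
  have lin2: "cross l (\<lambda>r. x r - y r) r = cross l x r - cross l y r" for x y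
    by (simp add: cross_def algebra_simps)
  have ll: "cross l l r = 0" by (simp add: cross_def)
  have f: "right_frame l w \<sigma> \<rho> 0 = (\<lambda>r. (w r - l r * (hinner l w / of_real (\<sigma>\<^sup>2))) * of_real (\<sigma> / \<rho>))"
    "right_frame l w \<sigma> \<rho> 1 = (\<lambda>r. cross (conj_vec l) w r * of_real (- 1 / \<rho>))"
    "right_frame l w \<sigma> \<rho> 2 = (\<lambda>r. l r * of_real (1 / \<sigma>))"
    by (auto simp: right_frame_def fun_eq_iff)
  show "cross l (right_frame l w \<sigma> \<rho> 0) r = left_frame l w \<sigma> \<rho> 0 r * of_real \<sigma>"
    unfolding f lin lin2 ll by (simp add: left_frame_def)
  show "cross l (right_frame l w \<sigma> \<rho> 2) r = 0"
    unfolding f lin ll by simp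
  show "cross l (right_frame l w \<sigma> \<rho> 1) r = left_frame l w \<sigma> \<rho> 1 r * of_real \<sigma>"
    unfolding f lin cross_cross_conj_vec[OF r] using \<sigma> \<rho>
    by (simp add: left_frame_def field_simps power2_eq_square)
qed

text \<open>
  A line through the point \<open>1\<close> of the unit circle meets the circle in one other point at most, so for
  \<open>c \<noteq> 0\<close> the parameter \<open>t\<close> is determined by the direction \<open>c\<close>.
\<close>

lemma norm_one_plus_eq_1:
  fixes c :: complex and t :: real
  assumes "cmod (1 + of_real t * c) = 1" "t \<noteq> 0"
  shows "t * (cmod c)\<^sup>2 = - 2 * Re c"
proof -
  have "(cmod (1 + of_real t * c))\<^sup>2 = 1" using assms by simp
  then have "t * (t * (cmod c)\<^sup>2 + 2 * Re c) = 0"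
    unfolding cmod_power2 by (simp add: algebra_simps power2_eq_square)
  then show ?thesis using assms by auto
qed

text \<open>
  If the cross product vanished, \<open>l 1 = \<beta> * l 2\<close>; then \<open>\<delta>3\<close> and \<open>\<beta> * \<delta>2\<close> would both be the
  parameter of the second intersection of the unit circle with the line through \<open>1\<close> in direction \<open>l 2\<close>.
\<close>

lemma cross_nonzero:
  fixes \<alpha> \<beta> \<delta>1 \<delta>2 \<delta>3 :: real
  assumes circle: "cmod (1 + of_real \<delta>1 * l 0) = 1" "cmod (1 + of_real \<delta>2 * l 1) = 1"
      "cmod (1 + of_real \<delta>3 * l 2) = 1"
    and w: "w 0 = of_real \<alpha>" "w 1 = of_real \<beta>" "w 2 = 1"
    and nz: "\<exists>r<3. l r \<noteq> 0" "\<delta>2 \<noteq> 0" "\<delta>3 \<noteq> 0" "\<beta> \<noteq> 0" and neq: "\<delta>3 \<noteq> \<beta> * \<delta>2"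
  shows "\<exists>r<3. cross l w r \<noteq> 0"
proof (rule ccontr)
  assume "\<not> ?thesis"
  then have "cross l w 0 = 0" "cross l w 1 = 0" by auto
  then have "l 1 * 1 = l 2 * of_real \<beta>" "l 2 * of_real \<alpha> = l 0 * 1"
    unfolding cross_simps w by simp_all
  then have l: "l 1 = of_real \<beta> * l 2" "l 0 = of_real \<alpha> * l 2"
    by (simp_all add: mult.commute)
  with nz(1) have c: "l 2 \<noteq> 0" by (metis less3_cases mult_zero_right)
  have "\<delta>3 * (cmod (l 2))\<^sup>2 = - 2 * Re (l 2)"
    using circle(3) nz by (intro norm_one_plus_eq_1)
  moreover have "(\<beta> * \<delta>2) * (cmod (l 2))\<^sup>2 = - 2 * Re (l 2)"
    using circle(2) nz l by (intro norm_one_plus_eq_1) (simp_all add: mult_ac)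
  ultimately have "\<delta>3 * (cmod (l 2))\<^sup>2 = (\<beta> * \<delta>2) * (cmod (l 2))\<^sup>2" by simp
  then show False using c neq by simp
qed

section \<open>The discrete curl on the grid\<close>

locale yee_grid =
  fixes n1 n2 n3 :: nat and dx dy dz a :: real and k :: "real vec" and \<alpha> \<beta> :: real
  assumes n: "n1 \<ge> 2" "n2 \<ge> 2" "n3 \<ge> 2"
    and mesh: "dx > 0" "dy > 0" "dz > 0" and a: "a > 0"
    and k: "k \<in> carrier_vec 3" "k \<noteq> 0\<^sub>v 3"
    and range: "\<And>l. l < 3 \<Longrightarrow> 0 \<le> k $ l \<and> k $ l \<le> 1 / (2 * a)"
    and \<beta>: "\<beta> \<noteq> 0" and neq: "dz \<noteq> \<beta> * dy"
begin

abbreviation "N \<equiv> n1 * n2 * n3"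
abbreviation "modes \<equiv> T_mat n1 n2 n3 a k"
abbreviation "modes3 \<equiv> 1\<^sub>m 3 \<otimes>\<^sub>K modes"

definition grid_dim :: "nat \<Rightarrow> nat" where "grid_dim l = (if l = 0 then n1 else if l = 1 then n2 else n3)"
definition step :: "nat \<Rightarrow> real" where "step l = (if l = 0 then dx else if l = 1 then dy else dz)"
text \<open>
  The mode in direction \<open>l\<close> that belongs to position \<open>i\<close> of the threefold Kronecker product, whose
  last factor varies fastest.
\<close>

definition digit :: "nat \<Rightarrow> nat \<Rightarrow> nat" where
  "digit l i = (if l = 0 then i mod (n2 * n1) mod n1 else if l = 1 then i mod (n2 * n1) div n1
     else i div (n2 * n1))"

text \<open>
  The vector \<open>ev i\<close> consists of the \<open>i\<close>-th diagonal entries of \<open>\<Lambda>\<^sub>1\<close>, \<open>\<Lambda>\<^sub>2\<close> and \<open>\<Lambda>\<^sub>3\<close>.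
\<close>

definition ev :: "nat \<Rightarrow> nat \<Rightarrow> complex" where
  "ev i l = of_real (inverse (step l)) * (bloch_root k (lattice_vec a l) (grid_dim l) (digit l i) - 1)"

definition trial :: "nat \<Rightarrow> complex" where
  "trial r = of_real (if r = 0 then \<alpha> else if r = 1 then \<beta> else 1)"

definition q_root :: "nat \<Rightarrow> real" where "q_root i = sqrt (\<Sum>s<3. (cmod (ev i s))\<^sup>2)"
definition p_root :: "nat \<Rightarrow> real" where "p_root i = sqrt (\<Sum>s<3. (cmod (cross (ev i) trial s))\<^sup>2)"

lemma trial_real: "cnj (trial r) = trial r" by (simp add: trial_def)

lemma digit_less: "i < N \<Longrightarrow> digit l i < grid_dim l"
  using n by (auto simp: digit_def grid_dim_def mult_ac intro: div_less_block less_mult_imp_div_less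
    mod_less_block)

lemma k_lattice_vec: "l < 3 \<Longrightarrow> k \<bullet> lattice_vec a l = a * k $ l"
  using k unfolding lattice_vec_def by simp

lemma ev_nonzero:
  assumes "i < N" shows "\<exists>l<3. ev i l \<noteq> 0"
proof -
  obtain l where l: "l < 3" "k $ l \<noteq> 0"
    using k by (metis carrier_vecD eq_vecI index_zero_vec)
  then have "0 < k $ l" using range[of l] by auto
  then have "0 < a * k $ l" using a by simp
  moreover have "a * k $ l < 1" using range[of l] l a by (simp add: field_simps)
  ultimately have "bloch_root k (lattice_vec a l) (grid_dim l) (digit l i) \<noteq> 1"
    using assms l n by (intro bloch_root_neq_1 digit_less) (auto simp: grid_dim_def k_lattice_vec)
  then show ?thesis using l mesh by (auto simp: ev_def step_def intro!: exI[of _ l])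
qed

text \<open>
  Undoing the shift by \<open>1\<close> and the scaling recovers a Bloch root, which has modulus \<open>1\<close>.
\<close>

lemma ev_circle: "cmod (1 + of_real (step l) * ev i l) = 1"
proof -
  have "of_real (step l) * ev i l = bloch_root k (lattice_vec a l) (grid_dim l) (digit l i) - 1"
    using mesh by (simp add: ev_def step_def)
  then show ?thesis by (simp add: norm_bloch_root)
qed

lemma cross_ev_nonzero:
  assumes "i < N" shows "\<exists>r<3. cross (ev i) trial r \<noteq> 0"
  using ev_circle[of 0 i] ev_circle[of 1 i] ev_circle[of 2 i]
  by (intro cross_nonzero[OF _ _ _ _ _ _ ev_nonzero[OF assms]])
    (use mesh \<beta> neq in \<open>auto simp: step_def trial_def\<close>)

lemma sum_cmod_pos: "\<exists>r<3. u r \<noteq> 0 \<Longrightarrow> 0 < (\<Sum>s<(3::nat). (cmod (u s))\<^sup>2)"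
  by (auto intro: sum_pos2)

lemma q_root_pos: "i < N \<Longrightarrow> q_root i > 0"
  and p_root_pos: "i < N \<Longrightarrow> p_root i > 0"
  unfolding q_root_def p_root_def using sum_cmod_pos ev_nonzero cross_ev_nonzero by auto

lemma hinner_ev: "hinner (ev i) (ev i) = of_real ((q_root i)\<^sup>2)"
  unfolding hinner_self q_root_def by (subst real_sqrt_pow2) (auto intro: sum_nonneg)

lemma hinner_cross_ev: "hinner (cross (ev i) trial) (cross (ev i) trial) = of_real ((p_root i)\<^sup>2)"
  unfolding hinner_self p_root_def by (subst real_sqrt_pow2) (auto intro: sum_nonneg)

lemma Lambda_eq:
  "Lambda1 n1 n2 n3 dx a k = mat_diag N (\<lambda>i. ev i 0)"
  "Lambda2 n1 n2 n3 dy a k = mat_diag N (\<lambda>i. ev i 1)"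
  "Lambda3 n1 n2 n3 dz a k = mat_diag N (\<lambda>i. ev i 2)"
proof -
  have N: "n3 * (n2 * n1) = N" by (simp add: mult_ac)
  show "Lambda1 n1 n2 n3 dx a k = mat_diag N (\<lambda>i. ev i 0)"
    "Lambda2 n1 n2 n3 dy a k = mat_diag N (\<lambda>i. ev i 1)"
    "Lambda3 n1 n2 n3 dz a k = mat_diag N (\<lambda>i. ev i 2)"
    unfolding Lambda1_def Lambda2_def Lambda3_def Lambda_mat_def mat_diag_one[symmetric]
      kronecker_mat_diag mat_diag_smult N
    by (simp_all add: ev_def bloch_root_def step_def grid_dim_def digit_def)
qed

lemma Lambda_q_eq: "Lambda_q n1 n2 n3 dx dy dz a k = mat_diag N (\<lambda>i. of_real ((q_root i)\<^sup>2))"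
  unfolding Lambda_q_def Lambda_eq mat_diag_adjoint mat_diag_diag mat_diag_add hinner_ev[symmetric]
  by (simp add: hinner_def sum3)

text \<open>
  \<open>\<Lambda>\<^sub>p\<close> collects the cross products of the eigenvalue vectors with \<open>(\<alpha>, \<beta>, 1)\<close>, up to sign, so \<open>\<Lambda>\<^sub>p\<^sup>* \<Lambda>\<^sub>p\<close> contains their
  squared norms.
\<close>

lemma Lambda_p_eq: "Lambda_p n1 n2 n3 dx dy dz a k \<alpha> \<beta> = fibre_mat N 3 1 (\<lambda>i r _. - cross (ev i) trial r)"
  unfolding Lambda_p_def Lambda_eq mat_diag_smult mat_diag_minus
  unfolding mat_diag_fibre_mat fibre_mat_append_rows
  by (simp add: numeral_3_eq_3, intro fibre_mat_cong)
    (auto simp: less_Suc_eq cross_simps cross_simps(4)[unfolded numeral_2_eq_2] trial_def numeral_2_eq_2)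

lemma Lambda_pp_eq:
  "mat_adjoint (Lambda_p n1 n2 n3 dx dy dz a k \<alpha> \<beta>) * Lambda_p n1 n2 n3 dx dy dz a k \<alpha> \<beta>
     = mat_diag N (\<lambda>i. of_real ((p_root i)\<^sup>2))"
  unfolding Lambda_p_eq fibre_mat_adjoint fibre_mat_mult mat_diag_fibre_mat hinner_cross_ev[symmetric]
  by (simp add: hinner_def)

lemma modes3_carrier [simp]: "modes3 \<in> carrier_mat (3 * N) (3 * N)"
  by (intro kronecker_carrier) auto

lemma modes3_isometry: "mat_adjoint modes3 * modes3 = 1\<^sub>m (3 * N)"
proof -
  have T: "mat_adjoint modes * modes = 1\<^sub>m N" by (rule T_mat_isometry) (use n in auto)
  have "mat_adjoint (1\<^sub>m 3 :: complex mat) = 1\<^sub>m 3" by (intro eq_matI) auto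
  then show ?thesis
    unfolding kronecker_adjoint
    by (subst kronecker_mult[of _ 3 3 _ 3 _ N N _ N]) (auto simp: T one_kronecker_one)
qed

lemma modes3_unitary: "modes3 * mat_adjoint modes3 = 1\<^sub>m (3 * N)"
  by (rule mat_mult_left_right_inverse[OF _ _ modes3_isometry]) auto

abbreviation "curl \<equiv> curl_mat n1 n2 n3 dx dy dz a k"
abbreviation "curl_symbol \<equiv> fibre_mat N 3 3 (\<lambda>i. cross_mat (ev i))"

text \<open>
  Indexing the three difference matrices by the direction lets the curl be written as one cross product.
\<close>

definition C_dir :: "nat \<Rightarrow> complex mat" where
  "C_dir l = (if l = 0 then C1 n1 n2 n3 dx a k else if l = 1 then C2 n1 n2 n3 dy a k
     else C3 n1 n2 n3 dz a k)"

lemma C_dir_carrier: "C_dir l \<in> carrier_mat N N"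
  unfolding C_dir_def C1_def C2_def C3_def by (auto simp: kronecker_def K_mat_def mult_ac)

lemma C_dir_mult_modes:
  assumes "l < 3" "i < N" "j < N"
  shows "(\<Sum>s<N. C_dir l $$ (i, s) * modes $$ (s, j)) = modes $$ (i, j) * ev j l"
proof -
  have "C_dir l * modes = modes * mat_diag N (\<lambda>i. ev i l)"
    using less3_cases[OF assms(1)] C_mult_T[OF n, of _ a k]
    by (auto simp: C_dir_def Lambda_eq)
  then have "(C_dir l * modes) $$ (i, j) = (modes * mat_diag N (\<lambda>i. ev i l)) $$ (i, j)" by simp
  moreover have "(C_dir l * modes) $$ (i, j) = (\<Sum>s<N. C_dir l $$ (i, s) * modes $$ (s, j))"
    using assms C_dir_carrier[of l] T_mat_carrier[of n1 n2 n3 a k]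
    by (simp add: scalar_prod_def atLeast0LessThan del: T_mat_carrier)
  moreover have "(modes * mat_diag N (\<lambda>i. ev i l)) $$ (i, j) = modes $$ (i, j) * ev j l"
    using assms by (subst mat_diag_mult_right[of _ N N]) auto
  ultimately show ?thesis by simp
qed

lemma curl_block_mat:
  "curl = block_mat N 3 3 (\<lambda>r c i j. cross_mat (\<lambda>l. C_dir l $$ (i, j)) r c)"
proof -
  have C: "C_dir l = block_mat N 1 1 (\<lambda>_ _ i j. C_dir l $$ (i, j))" for l
    by (rule single_block_mat[OF C_dir_carrier])
  have eq: "C1 n1 n2 n3 dx a k = block_mat N 1 1 (\<lambda>_ _ i j. C_dir 0 $$ (i, j))"
    "C2 n1 n2 n3 dy a k = block_mat N 1 1 (\<lambda>_ _ i j. C_dir 1 $$ (i, j))"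
    "C3 n1 n2 n3 dz a k = block_mat N 1 1 (\<lambda>_ _ i j. C_dir 2 $$ (i, j))"
    using C[of 0] C[of 1] C[of 2] by (simp_all add: C_dir_def)
  have z: "0\<^sub>m N N = block_mat N 1 1 (\<lambda>_ _ _ _. 0)" using block_mat_zero[of 1 N 1] by simp
  show ?thesis
    unfolding curl_mat_def Let_def grid_size_def eq z block_mat_uminus block_mat_append_cols
      block_mat_append_rows
    by (simp add: numeral_3_eq_3, intro block_mat_cong)
      (auto simp: less_Suc_eq cross_mat_def cross_simps cross_simps(4)[unfolded numeral_2_eq_2] numeral_2_eq_2)
qed

lemma curl_carrier: "curl \<in> carrier_mat (3 * N) (3 * N)"
  unfolding curl_block_mat by simp

text \<open>
  The entries of \<open>cross_mat\<close> are linear in its argument, so the equations \<open>C\<^sub>l T = T \<Lambda>\<^sub>l\<close> can be used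
  inside of it: the symbol of the curl is the cross product with the eigenvalue vector.
\<close>

lemma curl_mult_modes3: "curl * modes3 = modes3 * curl_symbol"
proof -
  have modes: "modes \<in> carrier_mat N N" by simp
  have "curl * modes3 = block_mat N 3 3 (\<lambda>r c i j. \<Sum>s<3. \<Sum>t<N. cross_mat (\<lambda>l. C_dir l $$ (i, t)) r s
      * (if s = c then modes $$ (t, j) else 0))"
    unfolding curl_block_mat one_kronecker_block_mat[OF modes] block_mat_mult ..
  also have "\<dots> = block_mat N 3 3 (\<lambda>r c i j. modes $$ (i, j) * cross_mat (ev j) r c)"
  proof (rule block_mat_cong)
    fix r c i j assume rc: "r < (3::nat)" "c < (3::nat)" and ij: "i < N" "j < N"
    have "(\<Sum>s<3. \<Sum>t<N. cross_mat (\<lambda>l. C_dir l $$ (i, t)) r s * (if s = c then modes $$ (t, j) else 0))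
        = (\<Sum>t<N. cross_mat (\<lambda>l. C_dir l $$ (i, t)) r c * modes $$ (t, j))"
      using rc less3_cases[OF rc(2)] by (auto simp: sum3)
    also have "\<dots> = (\<Sum>t<N. cross_mat (\<lambda>l. C_dir l $$ (i, t) * modes $$ (t, j)) r c)"
      by (simp add: cross_mat_def cross_def algebra_simps)
    also have "\<dots> = cross_mat (\<lambda>l. \<Sum>t<N. C_dir l $$ (i, t) * modes $$ (t, j)) r c"
      by (simp add: cross_mat_def cross_def sum_subtractf sum_distrib_right)
    also have "\<dots> = cross_mat (\<lambda>l. modes $$ (i, j) * ev j l) r c"
      using ij by (simp add: cross_mat_def cross_def C_dir_mult_modes)
    also have "\<dots> = modes $$ (i, j) * cross_mat (ev j) r c"
      by (simp add: cross_mat_def cross_def algebra_simps)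
    finally show "(\<Sum>s<3. \<Sum>t<N. cross_mat (\<lambda>l. C_dir l $$ (i, t)) r s * (if s = c then modes $$ (t, j) else 0))
        = modes $$ (i, j) * cross_mat (ev j) r c" .
  qed
  also have "\<dots> = modes3 * curl_symbol" by (simp add: one_kronecker_mult_fibre_mat)
  finally show ?thesis .
qed

lemma curl_symbol_carrier: "curl_symbol \<in> carrier_mat (3 * N) (3 * N)" by simp

lemma curl_eq: "curl = modes3 * curl_symbol * mat_adjoint modes3"
proof -
  have "curl = curl * (modes3 * mat_adjoint modes3)" using curl_carrier by (simp add: modes3_unitary)
  also have "\<dots> = curl * modes3 * mat_adjoint modes3"
    by (rule assoc_mult_mat[symmetric, OF curl_carrier modes3_carrier adjoint_carrier[OF modes3_carrier]])
  finally show ?thesis by (simp only: curl_mult_modes3)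
qed

text \<open>
  In the basis of Bloch modes the curl and its adjoint act by their symbols.
\<close>

lemma curl_mult:
  assumes X: "X \<in> carrier_mat (3 * N) m"
  shows "curl * (modes3 * X) = modes3 * (curl_symbol * X)" and "mat_adjoint curl * (modes3 * X) = modes3 * (mat_adjoint curl_symbol * X)"
proof -
  have W': "mat_adjoint modes3 \<in> carrier_mat (3 * N) (3 * N)"
    and L': "mat_adjoint curl_symbol \<in> carrier_mat (3 * N) (3 * N)" by simp_all
  have "curl * (modes3 * X) = curl * modes3 * X"
    by (rule assoc_mult_mat[symmetric, OF curl_carrier modes3_carrier X])
  also have "\<dots> = modes3 * (curl_symbol * X)" unfolding curl_mult_modes3
    by (rule assoc_mult_mat[OF modes3_carrier curl_symbol_carrier X])
  finally show "curl * (modes3 * X) = modes3 * (curl_symbol * X)" .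
  have WX: "modes3 * X \<in> carrier_mat (3 * N) m" using mult_carrier_mat[OF modes3_carrier X] .
  have WWX: "mat_adjoint modes3 * (modes3 * X) = X"
    using X by (simp add: assoc_mult_mat[OF W' modes3_carrier X, symmetric] modes3_isometry)
  have WWpm: "mat_adjoint (mat_adjoint modes3) = modes3" by (intro eq_matI) auto
  have "mat_adjoint curl = modes3 * (mat_adjoint curl_symbol * mat_adjoint modes3)"
    unfolding curl_eq
    by (simp only: adjoint_mult[OF mult_carrier_mat[OF modes3_carrier curl_symbol_carrier] W'] WWpm
        adjoint_mult[OF modes3_carrier curl_symbol_carrier])
  then have "mat_adjoint curl * (modes3 * X) = modes3 * (mat_adjoint curl_symbol * mat_adjoint modes3) * (modes3 * X)" by simp
  also have "\<dots> = modes3 * (mat_adjoint curl_symbol * mat_adjoint modes3 * (modes3 * X))"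
    by (rule assoc_mult_mat[OF modes3_carrier mult_carrier_mat[OF L' W'] WX])
  also have "\<dots> = modes3 * (mat_adjoint curl_symbol * X)"
    by (simp only: assoc_mult_mat[OF L' W' WX] WWX)
  finally show "mat_adjoint curl * (modes3 * X) = modes3 * (mat_adjoint curl_symbol * X)" .
qed

lemma modes3_mult_assoc:
  assumes "X \<in> carrier_mat (3 * N) m" "Y \<in> carrier_mat m p"
  shows "modes3 * X * Y = modes3 * (X * Y)"
  by (rule assoc_mult_mat[OF modes3_carrier assms])

abbreviation "trial_mat \<equiv> fibre_mat N 3 1 (\<lambda>i r _. trial r)"

lemma fibre_mat_carrier3: "fibre_mat N 3 C M \<in> carrier_mat (3 * N) (C * N)" by simp

lemma T1_eq: "T1_mat n1 n2 n3 a k \<alpha> \<beta> = modes3 * trial_mat"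
proof -
  have eq: "modes = block_mat N 1 1 (\<lambda>_ _ i j. modes $$ (i, j))"
    by (rule single_block_mat) simp
  have "T1_mat n1 n2 n3 a k \<alpha> \<beta> = block_mat N 3 1 (\<lambda>r c i j. modes $$ (i, j) * trial r)"
    unfolding T1_mat_def
    by (subst (1 2 3) eq, unfold block_mat_smult block_mat_append_rows, simp add: numeral_3_eq_3,
        intro block_mat_cong)
      (auto simp: less_Suc_eq trial_def)
  then show ?thesis by (simp add: one_kronecker_mult_fibre_mat)
qed

lemma csqrt_of_real_square: "csqrt (of_real (x\<^sup>2)) = of_real \<bar>x\<bar>"
  by (simp del: of_real_power)

abbreviation "rframe i \<equiv> right_frame (ev i) trial (q_root i) (p_root i)"
abbreviation "lframe i \<equiv> left_frame (ev i) trial (q_root i) (p_root i)"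

lemma Pi0_eq: "Pi0 n1 n2 n3 dx dy dz a k = fibre_mat N 3 1 (\<lambda>i r _. rframe i 2 r)"
  unfolding Pi0_def Lambda_eq Lambda_q_eq diag_inv_sqrt_mat_diag
  unfolding mat_diag_fibre_mat fibre_mat_append_rows csqrt_of_real_square
  by (simp add: numeral_3_eq_3 fibre_mat_mult, intro fibre_mat_cong)
    (auto simp: abs_of_pos[OF q_root_pos] less_Suc_eq right_frame_def divide_inverse numeral_2_eq_2)

lemma Q0_eq: "Q0 n1 n2 n3 dx dy dz a k = modes3 * fibre_mat N 3 1 (\<lambda>i r _. rframe i 2 r)"
  unfolding Q0_def Pi0_eq ..

lemma P0_eq: "P0 n1 n2 n3 dx dy dz a k = modes3 * fibre_mat N 3 1 (\<lambda>i r _. lframe i 2 r)"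
  unfolding P0_def Pi0_eq
  by (subst fibre_mat_map, simp, rule arg_cong[where f = "(*) modes3"], intro fibre_mat_cong)
    (simp add: right_frame_def left_frame_def conj_vec_def)

lemma diag_factors:
  "diag_inv_sqrt (mat_adjoint (Lambda_p n1 n2 n3 dx dy dz a k \<alpha> \<beta>) * Lambda_p n1 n2 n3 dx dy dz a k \<alpha> \<beta>)
     = fibre_mat N 1 1 (\<lambda>i _ _. of_real (1 / p_root i))"
  "diag_inv_sqrt (mat_adjoint (Lambda_p n1 n2 n3 dx dy dz a k \<alpha> \<beta>) * Lambda_p n1 n2 n3 dx dy dz a k \<alpha> \<beta>
      * diag_inverse (Lambda_q n1 n2 n3 dx dy dz a k))
     = fibre_mat N 1 1 (\<lambda>i _ _. of_real (q_root i / p_root i))"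
proof -
  show "diag_inv_sqrt (mat_adjoint (Lambda_p n1 n2 n3 dx dy dz a k \<alpha> \<beta>) * Lambda_p n1 n2 n3 dx dy dz a k \<alpha> \<beta>)
     = fibre_mat N 1 1 (\<lambda>i _ _. of_real (1 / p_root i))"
    unfolding Lambda_pp_eq diag_inv_sqrt_mat_diag csqrt_of_real_square
    unfolding mat_diag_fibre_mat
    by (intro fibre_mat_cong) (simp add: abs_of_pos[OF p_root_pos] divide_inverse)
  have "of_real ((p_root i)\<^sup>2) * inverse (of_real ((q_root i)\<^sup>2)) = (of_real ((p_root i / q_root i)\<^sup>2) :: complex)" for i
    by (simp add: power_mult_distrib power_inverse divide_inverse)
  then show "diag_inv_sqrt (mat_adjoint (Lambda_p n1 n2 n3 dx dy dz a k \<alpha> \<beta>) * Lambda_p n1 n2 n3 dx dy dz a k \<alpha> \<beta>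
      * diag_inverse (Lambda_q n1 n2 n3 dx dy dz a k))
     = fibre_mat N 1 1 (\<lambda>i _ _. of_real (q_root i / p_root i))"
    unfolding Lambda_pp_eq Lambda_q_eq diag_inverse_mat_diag mat_diag_diag diag_inv_sqrt_mat_diag
    unfolding mat_diag_fibre_mat
    by (simp only: csqrt_of_real_square, intro fibre_mat_cong)
      (simp add: abs_mult abs_of_pos[OF p_root_pos] abs_of_pos[OF q_root_pos] divide_inverse mult.commute)
qed

text \<open>
  The trial vector times \<open>I - (u / x) (u / x)\<^sup>*\<close>; the right-hand side is the form in which the
  projected trial vector enters both frames.
\<close>

lemma complement_eq:
  assumes "r < 3"
  shows "(\<Sum>s<3. ((if r = s then 1 else 0)
      - u r * of_real (1 / x) * (cnj (u s) * of_real (1 / x))) * trial s)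
    = trial r - u r * (hinner u trial / of_real (x\<^sup>2))"
proof -
  have "(\<Sum>s<3. ((if r = s then 1 else 0)
      - u r * of_real (1 / x) * (cnj (u s) * of_real (1 / x))) * trial s)
     = (\<Sum>s<3. (if r = s then trial s else 0)) - (\<Sum>s<3. u r * (cnj (u s) * trial s / of_real (x\<^sup>2)))"
    unfolding sum_subtractf[symmetric]
    by (intro sum.cong) (auto simp: algebra_simps power2_eq_square)
  then show ?thesis using assms
    by (simp add: hinner_def sum_distrib_left sum_divide_distrib)
qed

lemma complement_mult:
  "(1\<^sub>m (3 * N) - (modes3 * fibre_mat N 3 1 A) * mat_adjoint (modes3 * fibre_mat N 3 1 A)) * (modes3 * trial_mat) * fibre_mat N 1 1 D
    = modes3 * fibre_mat N 3 1 (\<lambda>i r c. (\<Sum>s<3. ((if r = s then 1 else 0) - A i r 0 * cnj (A i s 0)) * trial s) * D i 0 c)"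
proof -
  have "(1\<^sub>m (3 * N) - (modes3 * fibre_mat N 3 1 A) * mat_adjoint (modes3 * fibre_mat N 3 1 A)) * (modes3 * trial_mat)
      = modes3 * ((1\<^sub>m (3 * N) - fibre_mat N 3 1 A * mat_adjoint (fibre_mat N 3 1 A)) * trial_mat)"
    by (rule projection_complement[OF modes3_carrier modes3_isometry fibre_mat_carrier3 fibre_mat_carrier3])
  also have "(1\<^sub>m (3 * N) - fibre_mat N 3 1 A * mat_adjoint (fibre_mat N 3 1 A)) * trial_mat
      = fibre_mat N 3 1 (\<lambda>i r c. \<Sum>s<3. ((if r = s then 1 else 0) - A i r 0 * cnj (A i s 0)) * trial s)"
    unfolding fibre_mat_adjoint fibre_mat_mult one_fibre_mat fibre_mat_minus by simp
  finally show ?thesis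
    by (simp add: modes3_mult_assoc[OF fibre_mat_carrier3 fibre_mat_carrier] fibre_mat_mult)
qed

lemma Q1_eq: "Q1 n1 n2 n3 dx dy dz a k \<alpha> \<beta> = modes3 * fibre_mat N 3 1 (\<lambda>i r _. rframe i 0 r)"
  unfolding Q1_def grid_size_def Q0_eq T1_eq diag_factors complement_mult
  by (rule arg_cong[where f = "(*) modes3"], intro fibre_mat_cong)
    (simp add: right_frame_def complement_eq del: of_real_divide of_real_power)

lemma P1_eq: "P1 n1 n2 n3 dx dy dz a k \<alpha> \<beta> = modes3 * fibre_mat N 3 1 (\<lambda>i r _. lframe i 1 r)"
  unfolding P1_def grid_size_def P0_eq T1_eq diag_factors complement_mult
  by (rule arg_cong[where f = "(*) modes3"], intro fibre_mat_cong)
    (simp add: left_frame_def complement_eq del: of_real_divide of_real_power)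

lemma P2_eq: "P2 n1 n2 n3 dx dy dz a k \<alpha> \<beta> = modes3 * fibre_mat N 3 1 (\<lambda>i r _. lframe i 0 r)"
  unfolding P2_def T1_eq diag_factors curl_mult[OF fibre_mat_carrier3] fibre_mat_mult
    modes3_mult_assoc[OF fibre_mat_carrier3 fibre_mat_carrier]
  by (rule arg_cong[where f = "(*) modes3"], intro fibre_mat_cong)
    (simp add: left_frame_def cross_mat_apply)

lemma Q2_eq: "Q2 n1 n2 n3 dx dy dz a k \<alpha> \<beta> = modes3 * fibre_mat N 3 1 (\<lambda>i r _. rframe i 1 r)"
  unfolding Q2_def T1_eq diag_factors curl_mult[OF fibre_mat_carrier3] fibre_mat_mult fibre_mat_adjoint
    modes3_mult_assoc[OF fibre_mat_carrier3 fibre_mat_carrier]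
  by (rule arg_cong[where f = "(*) modes3"], intro fibre_mat_cong)
    (simp add: right_frame_def cross_mat_adjoint_apply)

abbreviation "right_frames C \<equiv> fibre_mat N 3 C (\<lambda>i r c. rframe i c r)"
abbreviation "left_frames C \<equiv> fibre_mat N 3 C (\<lambda>i r c. lframe i c r)"
abbreviation "singular_values C \<equiv> fibre_mat N C C (\<lambda>i r c. if r = c \<and> r < 2 then of_real (q_root i) else 0)"

lemma modes3_append_cols:
  "modes3 * fibre_mat N 3 C M @\<^sub>c modes3 * fibre_mat N 3 D M' =
     modes3 * fibre_mat N 3 (C + D) (\<lambda>i r c. if c < C then M i r c else M' i r (c - C))"
  by (rule one_kronecker_append_cols) simp

text \<open>
  The orders \<open>[Q\<^sub>1, Q\<^sub>2, Q\<^sub>0]\<close> and \<open>[P\<^sub>2, P\<^sub>1, P\<^sub>0]\<close> of the blocks are those in which each right singular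
  vector meets its image.
\<close>

lemma frames_eq:
  "Q_r n1 n2 n3 dx dy dz a k \<alpha> \<beta> = modes3 * right_frames 2"
  "P_r n1 n2 n3 dx dy dz a k \<alpha> \<beta> = modes3 * left_frames 2"
  "Q_full n1 n2 n3 dx dy dz a k \<alpha> \<beta> = modes3 * right_frames 3"
  "P_full n1 n2 n3 dx dy dz a k \<alpha> \<beta> = modes3 * left_frames 3"
  unfolding Q_r_def P_r_def Q_full_def P_full_def Q0_eq Q1_eq Q2_eq P0_eq P1_eq P2_eq modes3_append_cols
  by (simp_all add: numeral_3_eq_3 numeral_2_eq_2)
    (rule arg_cong[where f = "(*) _"], rule fibre_mat_cong, auto simp: less_Suc_eq numeral_2_eq_2)+

lemma diag_sqrt_Lambda_q: "diag_sqrt (Lambda_q n1 n2 n3 dx dy dz a k) = fibre_mat N 1 1 (\<lambda>i _ _. of_real (q_root i))"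
  unfolding Lambda_q_eq diag_sqrt_mat_diag csqrt_of_real_square
  unfolding mat_diag_fibre_mat by (intro fibre_mat_cong) (simp add: abs_of_pos[OF q_root_pos])

lemma Sigma_eq:
  "Sigma_r n1 n2 n3 dx dy dz a k = singular_values 2"
  "Sigma_full n1 n2 n3 dx dy dz a k = singular_values 3"
proof -
  have z: "0\<^sub>m N N = fibre_mat N 1 1 (\<lambda>_ _ _. 0)" using zero_fibre_mat[of 1 N 1] by simp
  have dims: "diag_block_mat [fibre_mat N R R M] = fibre_mat N R R M"
    "diag_block_mat (fibre_mat N R R M # A # As) =
      four_block_mat (fibre_mat N R R M) (0\<^sub>m (R * N) (dim_col (diag_block_mat (A # As))))
        (0\<^sub>m (dim_row (diag_block_mat (A # As))) (R * N)) (diag_block_mat (A # As))"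
    "dim_row (fibre_mat N R C M) = R * N" "dim_col (fibre_mat N R C M) = C * N" for R C M A As
    by (simp_all only: diag_block_mat_singleton diag_block_mat.simps(2)[of _ "_ # _"] Let_def)
      (simp_all add: fibre_mat_def)
  show "Sigma_r n1 n2 n3 dx dy dz a k = singular_values 2"
    unfolding Sigma_r_def diag_sqrt_Lambda_q
    by (simp only: dims diag_block_fibre_mat)
      (simp add: numeral_2_eq_2, intro fibre_mat_cong, auto simp: less_Suc_eq)
  show "Sigma_full n1 n2 n3 dx dy dz a k = singular_values 3"
    unfolding Sigma_full_def diag_sqrt_Lambda_q grid_size_def z
    by (simp only: dims diag_block_fibre_mat)
      (simp add: numeral_3_eq_3, intro fibre_mat_cong, auto simp: less_Suc_eq numeral_2_eq_2)
qed

lemma frames_orthonormal: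
  "mat_adjoint (right_frames 3) * right_frames 3 = 1\<^sub>m (3 * N)" "mat_adjoint (left_frames 3) * left_frames 3 = 1\<^sub>m (3 * N)"
  unfolding fibre_mat_adjoint fibre_mat_mult one_fibre_mat
  by (intro fibre_mat_cong;
      simp add: right_frame_orthonormal[unfolded hinner_def] left_frame_orthonormal[unfolded hinner_def]
       trial_real q_root_pos p_root_pos hinner_ev[unfolded hinner_def] hinner_cross_ev[unfolded hinner_def]
       del: of_real_power)+

lemma curl_symbol_mult_right_frames: "curl_symbol * right_frames 3 = left_frames 3 * singular_values 3"
  unfolding fibre_mat_mult
proof (rule fibre_mat_cong)
  fix i r c :: nat assume *: "i < N" "r < 3" "c < 3"
  show "(\<Sum>s<3. cross_mat (ev i) r s * rframe i c s) =
    (\<Sum>s<3. lframe i s r * (if s = c \<and> s < 2 then of_real (q_root i) else 0))"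
    using less3_cases[OF *(3)] cross_right_frame[OF q_root_pos hinner_ev p_root_pos, OF *(1) *(1,2)]
    by (auto simp: cross_mat_apply[OF *(2)] sum3)
qed

text \<open>
  An isometric square matrix is unitary, and products of isometries are isometries.
\<close>

lemma unitary_modes3_mult:
  assumes X: "X \<in> carrier_mat (3 * N) (3 * N)" "mat_adjoint X * X = 1\<^sub>m (3 * N)"
  shows "unitary_mat (modes3 * X)"
proof -
  have WX: "modes3 * X \<in> carrier_mat (3 * N) (3 * N)" by (rule mult_carrier_mat[OF modes3_carrier X(1)])
  have X': "mat_adjoint X \<in> carrier_mat (3 * N) (3 * N)" using X(1) by simp
  have W': "mat_adjoint modes3 \<in> carrier_mat (3 * N) (3 * N)" by simp
  have "mat_adjoint (modes3 * X) * (modes3 * X) = mat_adjoint X * (mat_adjoint modes3 * (modes3 * X))"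
    by (simp only: adjoint_mult[OF modes3_carrier X(1)] assoc_mult_mat[OF X' W' WX])
  also have "mat_adjoint modes3 * (modes3 * X) = X"
    using X(1) by (simp add: assoc_mult_mat[OF W' modes3_carrier X(1), symmetric] modes3_isometry)
  finally have 1: "mat_adjoint (modes3 * X) * (modes3 * X) = 1\<^sub>m (3 * N)" using X(2) by simp
  then have "modes3 * X * mat_adjoint (modes3 * X) = 1\<^sub>m (3 * N)"
    using mat_mult_left_right_inverse[OF _ WX 1] WX by simp
  with 1 show ?thesis
    unfolding unitary_mat_def square_mat.simps carrier_matD[OF WX] by simp
qed

text \<open>
  Multiplying \<open>curl_symbol * right_frames = left_frames * singular_values\<close> by the inverse of the unitary
  right factor gives the full decomposition; the third singular value is \<open>0\<close>, so the third columns
  contribute nothing and may be dropped.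
\<close>

lemma curl_symbol_svd:
  "curl_symbol = left_frames 3 * singular_values 3 * mat_adjoint (right_frames 3)"
  "curl_symbol = left_frames 2 * singular_values 2 * mat_adjoint (right_frames 2)"
proof -
  let ?R = "right_frames 3"
  have R: "?R \<in> carrier_mat (3 * N) (3 * N)" "mat_adjoint ?R \<in> carrier_mat (3 * N) (3 * N)" by simp_all
  have "?R * mat_adjoint ?R = 1\<^sub>m (3 * N)"
    by (rule mat_mult_left_right_inverse[OF R(2,1) frames_orthonormal(1)])
  then have "curl_symbol = curl_symbol * (?R * mat_adjoint ?R)" by (simp only: right_mult_one_mat[OF curl_symbol_carrier])
  also have "\<dots> = left_frames 3 * singular_values 3 * mat_adjoint ?R"
    by (simp only: assoc_mult_mat[OF curl_symbol_carrier R, symmetric] curl_symbol_mult_right_frames)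
  finally show 3: "curl_symbol = left_frames 3 * singular_values 3 * mat_adjoint (right_frames 3)" .
  also have "\<dots> = left_frames 2 * singular_values 2 * mat_adjoint (right_frames 2)"
    unfolding fibre_mat_mult fibre_mat_adjoint
    by (intro fibre_mat_cong) (simp add: sum3 numeral_2_eq_2)
  finally show "curl_symbol = left_frames 2 * singular_values 2 * mat_adjoint (right_frames 2)" .
qed

text \<open>
  A factorization of the symbol becomes one of the curl when the modes are absorbed into the outer factors.
\<close>

lemma curl_factor:
  assumes P: "P \<in> carrier_mat (3 * N) m" and S: "S \<in> carrier_mat m m" and Q: "Q \<in> carrier_mat (3 * N) m"
    and eq: "curl_symbol = P * S * mat_adjoint Q"
  shows "curl = (modes3 * P) * S * mat_adjoint (modes3 * Q)"
proof -
  have Q': "mat_adjoint Q \<in> carrier_mat m (3 * N)" using Q by simp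
  have W': "mat_adjoint modes3 \<in> carrier_mat (3 * N) (3 * N)" by simp
  have PS: "P * S \<in> carrier_mat (3 * N) m" by (rule mult_carrier_mat[OF P S])
  have "curl = modes3 * (P * S * mat_adjoint Q) * mat_adjoint modes3" unfolding curl_eq eq ..
  also have "\<dots> = modes3 * (P * S) * mat_adjoint Q * mat_adjoint modes3"
    by (simp only: assoc_mult_mat[OF modes3_carrier PS Q'])
  also have "\<dots> = modes3 * (P * S) * (mat_adjoint Q * mat_adjoint modes3)"
    by (rule assoc_mult_mat[OF mult_carrier_mat[OF modes3_carrier PS] Q' W'])
  also have "\<dots> = modes3 * P * S * mat_adjoint (modes3 * Q)"
    by (simp only: assoc_mult_mat[OF modes3_carrier P S] adjoint_mult[OF modes3_carrier Q])
  finally show ?thesis .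
qed

theorem svd:
  "is_svd curl (P_full n1 n2 n3 dx dy dz a k \<alpha> \<beta>) (Sigma_full n1 n2 n3 dx dy dz a k)
     (Q_full n1 n2 n3 dx dy dz a k \<alpha> \<beta>)"
  "curl = P_r n1 n2 n3 dx dy dz a k \<alpha> \<beta> * Sigma_r n1 n2 n3 dx dy dz a k
     * mat_adjoint (Q_r n1 n2 n3 dx dy dz a k \<alpha> \<beta>)"
proof -
  show "curl = P_r n1 n2 n3 dx dy dz a k \<alpha> \<beta> * Sigma_r n1 n2 n3 dx dy dz a k
     * mat_adjoint (Q_r n1 n2 n3 dx dy dz a k \<alpha> \<beta>)"
    unfolding frames_eq Sigma_eq
    by (rule curl_factor[OF fibre_mat_carrier3 fibre_mat_carrier fibre_mat_carrier3 curl_symbol_svd(2)])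
  have "0 \<le> singular_values 3 $$ (i, i)" if "i < 3 * N" for i
    using that q_root_pos[of "i mod N"] mod_less_block[OF that]
    by (simp add: fibre_mat_diag_index less_eq_complex_def)
  moreover have "diagonal_mat (singular_values 3)" by (rule fibre_mat_diagonal) simp
  moreover have "curl = modes3 * left_frames 3 * singular_values 3 * mat_adjoint (modes3 * right_frames 3)"
    by (rule curl_factor[OF fibre_mat_carrier3 fibre_mat_carrier fibre_mat_carrier3 curl_symbol_svd(1)])
  ultimately show "is_svd curl (P_full n1 n2 n3 dx dy dz a k \<alpha> \<beta>) (Sigma_full n1 n2 n3 dx dy dz a k)
     (Q_full n1 n2 n3 dx dy dz a k \<alpha> \<beta>)"
    unfolding frames_eq Sigma_eq is_svd_def
    using unitary_modes3_mult[OF fibre_mat_carrier3 frames_orthonormal(1)] unitary_modes3_mult[OF fibre_mat_carrier3 frames_orthonormal(2)]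
      mult_carrier_mat[OF modes3_carrier fibre_mat_carrier3] curl_carrier
    by auto
qed

end

theorem theorem2p5:
  fixes n1 n2 n3 :: nat
    and dx dy dz a :: real
    and k :: "real vec"
    and \<alpha> \<beta> :: real
  assumes "n1 \<ge> 2" and "n2 \<ge> 2" and "n3 \<ge> 2"
    and "dx > 0" and "dy > 0" and "dz > 0" and "a > 0"
    and "k \<in> carrier_vec 3"
    and "k \<noteq> 0\<^sub>v 3"
    and "\<forall>l<3. 0 \<le> k $ l \<and> k $ l \<le> 1 / (2 * a)"
    and "\<alpha> \<noteq> 0" and "\<beta> \<noteq> 0"
    and "\<alpha> * dx \<noteq> \<beta> * dy" and "dz \<noteq> \<beta> * dy"
  shows
    "let C = curl_mat n1 n2 n3 dx dy dz a k;
         P = P_full n1 n2 n3 dx dy dz a k \<alpha> \<beta>;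
         Q = Q_full n1 n2 n3 dx dy dz a k \<alpha> \<beta>;
         S = Sigma_full n1 n2 n3 dx dy dz a k;
         Pr = P_r n1 n2 n3 dx dy dz a k \<alpha> \<beta>;
         Qr = Q_r n1 n2 n3 dx dy dz a k \<alpha> \<beta>;
         Sr = Sigma_r n1 n2 n3 dx dy dz a k
     in C \<in> carrier_mat (3 * (n1 * n2 * n3)) (3 * (n1 * n2 * n3))
        \<and> is_svd C P S Q
        \<and> C = Pr * Sr * mat_adjoint Qr"
proof -
  interpret yee_grid n1 n2 n3 dx dy dz a k \<alpha> \<beta>
    using assms by unfold_locales auto
  show ?thesis unfolding Let_def using curl_carrier svd by blast
qed

end
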